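(* Let $n\ge1$. For any $\gamma\in\mathbb{C}$ and $\tau\in\mathbb{R}$, let $$H_\tau^\gamma(s,x,y,x',y')=\frac{\tau^n e^{-\gamma s\tau/4}}{(4\pi)^n\sinh^n(s\tau/4)}\;e^{-\frac{\tau}{4}\coth(s\tau/4)\left(|x-x'|^2+|y-y'|^2\right)-i\frac{\tau}{2}(x-x')\cdot(y+y')}$$ for $s>0$ and $x,y,x',y'\in\mathbb{R}^n$. Then $H_\tau^\gamma$ is the heat kernel which satisfies the following property: if $f\in L^2(\mathbb{C}^n)$, then $$H_\tau^\gamma[f](s,x,y)=\int_{\mathbb{R}^n\times\mathbb{R}^n}H_\tau^\gamma(s,x,y,x',y')\,f(x',y')\,dx'\,dy'$$ is a solution to the following initial value problem for the heat equation: $$\Big(\frac{\partial}{\partial s}+\tilde{\mathcal{L}}_\gamma\Big)H_\tau^\gamma[f]=0\quad(s>0),\qquad H_\tau^\gamma[f](s=0,x,y)=f(x,y).$$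
   Context: $\mathbb{C}^n$ is identified with $\mathbb{R}^n\times\mathbb{R}^n$ via $z=x+iy$. For $\gamma\in\mathbb{C}$ and $\tau\in\mathbb{R}$, $\tilde{\mathcal{L}}_\gamma$ is the differential operator in $(x,y)\in\mathbb{R}^n\times\mathbb{R}^n$ given by $$\tilde{\mathcal{L}}_\gamma=-\frac14\Big(\triangle_{x,y}+2i\tau\,y\cdot\nabla_x-(\tau^2\,y\cdot y+\gamma\tau)\Big),$$ where $\triangle_{x,y}=\sum_{j=1}^n\big(\partial_{x_j}^2+\partial_{y_j}^2\big)$ is the Laplacian in both the $x$ and $y$ variables, $\nabla_x$ is the gradient in $x$, and $\cdot$ is the standard dot product. The initial condition means that $H_\tau^\gamma[f](s,\cdot,\cdot)\to f$ in $L^2(\mathbb{R}^n\times\mathbb{R}^n)$ as $s\to0^+$. At $\tau=0$ the kernel is interpreted by continuity in $\tau$, i.e. $\tau/\sinh(s\tau/4)$ and $\tau\coth(s\tau/4)$ are both replaced by $4/s$. *)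

theory Defs
  imports "HOL-Analysis.Analysis"
begin

text \<open>
  The complex space of dimension \<open>n = CARD('n)\<close> is the Euclidean space
  \<open>(real^'n) \<times> (real^'n)\<close>, the pair \<open>(x, y)\<close> standing for \<open>x + iy\<close>.
\<close>

definition square_integrable :: "('a::euclidean_space \<Rightarrow> complex) \<Rightarrow> bool" where
  "square_integrable f \<longleftrightarrow>
     f \<in> borel_measurable lebesgue \<and> integrable lebesgue (\<lambda>z. (cmod (f z))\<^sup>2)"

definition L2_norm :: "('a::euclidean_space \<Rightarrow> complex) \<Rightarrow> real" where
  "L2_norm f = sqrt (LINT z|lebesgue. (cmod (f z))\<^sup>2)"

text \<open>
  \<open>\<tau> / sinh (s\<tau>/4)\<close> and \<open>\<tau> coth (s\<tau>/4)\<close>, extended to \<open>\<tau> = 0\<close> by their common limit \<open>4/s\<close>.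
\<close>

definition tau_csch :: "real \<Rightarrow> real \<Rightarrow> real" where
  "tau_csch \<tau> s = (if \<tau> = 0 then 4 / s else \<tau> / sinh (s * \<tau> / 4))"

definition tau_coth :: "real \<Rightarrow> real \<Rightarrow> real" where
  "tau_coth \<tau> s = (if \<tau> = 0 then 4 / s else \<tau> * (cosh (s * \<tau> / 4) / sinh (s * \<tau> / 4)))"

definition heat_kernel ::
  "complex \<Rightarrow> real \<Rightarrow> real \<Rightarrow> real^'n \<Rightarrow> real^'n \<Rightarrow> real^'n \<Rightarrow> real^'n \<Rightarrow> complex" where
  "heat_kernel \<gamma> \<tau> s x y x' y' =
     complex_of_real (tau_csch \<tau> s ^ CARD('n) / (4 * pi) ^ CARD('n))
     * exp (- \<gamma> * of_real (s * \<tau> / 4))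
     * exp (- of_real (tau_coth \<tau> s / 4 * ((norm (x - x'))\<^sup>2 + (norm (y - y'))\<^sup>2))
            - \<i> * of_real (\<tau> / 2 * ((x - x') \<bullet> (y + y'))))"

definition heat_integral ::
  "complex \<Rightarrow> real \<Rightarrow> ((real^'n) \<times> (real^'n) \<Rightarrow> complex)
    \<Rightarrow> real \<Rightarrow> (real^'n) \<times> (real^'n) \<Rightarrow> complex" where
  "heat_integral \<gamma> \<tau> f s = (\<lambda>(x, y).
     LINT (x', y')|lebesgue. heat_kernel \<gamma> \<tau> s x y x' y' * f (x', y'))"

definition dir_deriv ::
  "'a::real_normed_vector \<Rightarrow> ('a \<Rightarrow> complex) \<Rightarrow> 'a \<Rightarrow> complex" where
  "dir_deriv e u z = vector_derivative (\<lambda>t::real. u (z + t *\<^sub>R e)) (at 0)"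

definition has_dir_deriv ::
  "'a::real_normed_vector \<Rightarrow> ('a \<Rightarrow> complex) \<Rightarrow> 'a \<Rightarrow> bool" where
  "has_dir_deriv e u z \<longleftrightarrow> (\<lambda>t::real. u (z + t *\<^sub>R e)) differentiable (at 0)"

abbreviation partial_x ::
  "'n \<Rightarrow> ((real^'n) \<times> (real^'n) \<Rightarrow> complex) \<Rightarrow> (real^'n) \<times> (real^'n) \<Rightarrow> complex" where
  "partial_x j \<equiv> dir_deriv (axis j 1, 0)"

abbreviation partial_y ::
  "'n \<Rightarrow> ((real^'n) \<times> (real^'n) \<Rightarrow> complex) \<Rightarrow> (real^'n) \<times> (real^'n) \<Rightarrow> complex" where
  "partial_y j \<equiv> dir_deriv (0, axis j 1)"

definition L_tilde ::
  "complex \<Rightarrow> real \<Rightarrow> ((real^'n) \<times> (real^'n) \<Rightarrow> complex)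
    \<Rightarrow> (real^'n) \<times> (real^'n) \<Rightarrow> complex" where
  "L_tilde \<gamma> \<tau> u = (\<lambda>(x, y). - (1 / 4) *
     ((\<Sum>j\<in>UNIV. partial_x j (partial_x j u) (x, y) + partial_y j (partial_y j u) (x, y))
      + 2 * \<i> * of_real \<tau> * (\<Sum>j\<in>UNIV. of_real (y $ j) * partial_x j u (x, y))
      - (of_real (\<tau>\<^sup>2 * (y \<bullet> y)) + \<gamma> * of_real \<tau>) * u (x, y)))"

text \<open>
  Classical regularity for a parabolic equation of second order: for \<open>s > 0\<close>, \<open>u\<close> is once
  continuously differentiable in \<open>s\<close> and twice in the space variable, all these partial
  derivatives being jointly continuous. The existence clauses are needed because
  \<^const>\<open>vector_derivative\<close> is total.
\<close>

definition C12_pos :: "(real \<Rightarrow> 'a::euclidean_space \<Rightarrow> complex) \<Rightarrow> bool" where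
  "C12_pos u \<longleftrightarrow>
     (\<forall>s>0. \<forall>z. (\<lambda>\<sigma>. u \<sigma> z) differentiable (at s)) \<and>
     continuous_on ({0<..} \<times> UNIV) (\<lambda>(s, z). vector_derivative (\<lambda>\<sigma>. u \<sigma> z) (at s)) \<and>
     (\<forall>e\<in>Basis.
        (\<forall>s>0. \<forall>z. has_dir_deriv e (u s) z) \<and>
        continuous_on ({0<..} \<times> UNIV) (\<lambda>(s, z). dir_deriv e (u s) z)) \<and>
     (\<forall>e\<in>Basis. \<forall>e'\<in>Basis.
        (\<forall>s>0. \<forall>z. has_dir_deriv e' (dir_deriv e (u s)) z) \<and>
        continuous_on ({0<..} \<times> UNIV) (\<lambda>(s, z). dir_deriv e' (dir_deriv e (u s)) z))"

end

theory Submission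
  imports Defs "HOL-Probability.Distributions" "HOL-Real_Asymp.Real_Asymp"
begin

text \<open>
Write \<open>z = (x, y)\<close>, \<open>w = (x', y')\<close>, \<open>c = tau_coth \<tau> s\<close>, \<open>S = tau_csch \<tau> s\<close> and \<open>n = CARD('n)\<close>.

The kernel is \<open>(S / (4 * pi)) ^ n\<close> times the exponential of a quadratic polynomial in \<open>z\<close> and \<open>w\<close> whose
real part is, up to a constant, \<open>- c / 4 * (norm (z - w))\<^sup>2\<close>. Hence every derivative of the kernel is
the kernel times a polynomial, and the heat equation for the kernel becomes a polynomial identity
(\<open>log_identity\<close>), which decouples into the coordinates and follows from \<open>S' = - S c / 4\<close>,
\<open>c' = - S\<^sup>2 / 4\<close> and \<open>c\<^sup>2 - \<tau>\<^sup>2 = S\<^sup>2\<close>.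

These derivatives are bounded by Gaussians in \<open>w\<close>, locally uniformly in \<open>(s, z)\<close>, and a Gaussian times a
square integrable function is integrable. Dominated convergence therefore allows differentiation
under the integral sign (\<open>gauss_dominated_has_vector_derivative\<close>) and shows that the resulting integrals are
jointly continuous. So the integral of the kernel against \<open>f\<close> has the required regularity and inherits the equation.

For the initial value, substitute \<open>w = z + v\<close>. Then the kernel is the scalar
\<open>exp (- \<gamma> s \<tau> / 4) / cosh (s \<tau> / 4) ^ n\<close>, which tends to \<open>1\<close>, times the centred Gaussian probability density
with parameter \<open>c / 4 \<rightarrow> \<infinity>\<close>, times a unimodular factor that equals \<open>1\<close> for \<open>v = 0\<close>. By Jensen and Tonelli
(\<open>twisted_average_diff_le\<close>) the squared \<open>L\<^sup>2\<close> distance between the average of twisted translates of \<open>f\<close>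
and \<open>f\<close> itself is at most the Gaussian average of the squared distances between the single twisted
translate and \<open>f\<close>. These are bounded by four times the squared norm of \<open>f\<close>, and they tend to \<open>0\<close> with \<open>v\<close> because
translations act continuously on \<open>L\<^sup>2\<close> (\<open>twisted_modulus_small\<close>), which is clear on the dense set of
continuous functions of bounded support. As the density concentrates at \<open>0\<close>, the average of these distances tends to \<open>0\<close>.
\<close>

section \<open>Gaussian integrals and approximation by continuous functions\<close>

text \<open>
The square of the norm is the sum of the squares of the coordinates, so the integral is a
product of one-dimensional Gaussian integrals, known from the normal density.
\<close>

lemma nn_integral_gaussian:
  fixes a :: real
  assumes "a > 0"
  shows "(\<integral>\<^sup>+(x::'a::euclidean_space). ennreal (exp (- a * (norm x)\<^sup>2)) \<partial>lborel)
    = ennreal (sqrt (pi / a) ^ DIM('a))"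
proof -
  have one: "(\<integral>\<^sup>+(x::real). ennreal (exp (- a * x\<^sup>2)) \<partial>lborel) = ennreal (sqrt (pi / a))"
  proof -
    define \<sigma> where "\<sigma> = 1 / sqrt (2 * a)"
    have s: "\<sigma> > 0" "\<sigma>\<^sup>2 = 1 / (2 * a)" 
      using assms by (auto simp: \<sigma>_def power_divide)
    have "exp (- a * x\<^sup>2) = sqrt (pi / a) * normal_density 0 \<sigma> x" for x
      using assms by (simp add: normal_density_def s real_sqrt_divide)
    then have "(\<integral>\<^sup>+(x::real). ennreal (exp (- a * x\<^sup>2)) \<partial>lborel)
      = (\<integral>\<^sup>+x. ennreal (sqrt (pi / a)) * ennreal (normal_density 0 \<sigma> x) \<partial>lborel)"
      using assms by (intro nn_integral_cong) (simp add: ennreal_mult' del: ennreal_mult)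
    also have "\<dots> = ennreal (sqrt (pi / a)) * (\<integral>\<^sup>+x. ennreal (normal_density 0 \<sigma> x) \<partial>lborel)"
      by (rule nn_integral_cmult) auto
    also have "(\<integral>\<^sup>+x. ennreal (normal_density 0 \<sigma> x) \<partial>lborel) = 1"
      using prob_space.emeasure_space_1[OF prob_space_normal_density[OF s(1), of 0]]
      by (simp add: emeasure_density)
    finally show ?thesis by simp
  qed
  have "(\<integral>\<^sup>+(x::'a). ennreal (exp (- a * (norm x)\<^sup>2)) \<partial>lborel)
    = (\<integral>\<^sup>+(x::'a). ennreal (\<Prod>b\<in>Basis. exp (- a * (x \<bullet> b)\<^sup>2)) \<partial>lborel)"
  proof (intro nn_integral_cong)
    fix x :: 'a
    have "(norm x)\<^sup>2 = (\<Sum>b\<in>Basis. (x \<bullet> b)\<^sup>2)"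
      unfolding power2_norm_eq_inner euclidean_inner[of x x] by (simp add: power2_eq_square)
    then show "ennreal (exp (- a * (norm x)\<^sup>2)) = ennreal (\<Prod>b\<in>Basis. exp (- a * (x \<bullet> b)\<^sup>2))"
      by (simp add: prod_ennreal exp_sum[symmetric] sum_distrib_left sum_negf)
  qed
  also have "\<dots> = (\<Prod>b\<in>(Basis::'a set). (\<integral>\<^sup>+x. ennreal (exp (- a * x\<^sup>2)) \<partial>lborel))"
    using nn_integral_lborel_prod[of "\<lambda>(b::'a) x. exp (- a * x\<^sup>2)"] by (simp add: prod_ennreal)
  also have "\<dots> = ennreal (sqrt (pi / a) ^ DIM('a))"
    unfolding one using assms by (simp add: ennreal_power)
  finally show ?thesis .
qed

lemma integrable_gaussian:
  fixes a :: real
  assumes "a > 0"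
  shows "integrable lebesgue (\<lambda>x::'a::euclidean_space. exp (- a * (norm x)\<^sup>2))"
proof (subst integrable_completion)
  show "integrable lborel (\<lambda>x::'a. exp (- a * (norm x)\<^sup>2))"
    using nn_integral_gaussian[OF assms, where 'a='a]
    by (intro integrableI_bounded) auto
qed auto

lemma cmod_diff_square_le: "(cmod (x - y))\<^sup>2 \<le> 2 * (cmod x)\<^sup>2 + 2 * (cmod y)\<^sup>2"
proof -
  have "(cmod (x - y))\<^sup>2 \<le> (cmod x + cmod y)\<^sup>2"
    by (intro power_mono norm_triangle_ineq4) auto
  then show ?thesis
    using sum_squares_bound[of "cmod x" "cmod y"] by (simp add: power2_sum)
qed

text \<open>
The radial retraction of the plane onto the disc of radius \<open>R\<close>; together with a cutoff it turns
a continuous function into a bounded one of bounded support.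
\<close>

definition radial_clamp :: "real \<Rightarrow> complex \<Rightarrow> complex" where
  "radial_clamp R c = c /\<^sub>R max 1 (cmod c / R)"

lemma cmod_radial_clamp_le:
  assumes "R > 0"
  shows "cmod (radial_clamp R c) \<le> R" "cmod (radial_clamp R c) \<le> cmod c"
proof -
  have "cmod c \<le> max 1 (cmod c / R) * R"
    using assms by (simp add: max_mult_distrib_right)
  then show "cmod (radial_clamp R c) \<le> R"
    by (simp add: radial_clamp_def divide_simps max.strict_coboundedI1 mult.commute)
  show "cmod (radial_clamp R c) \<le> cmod c"
    by (simp add: radial_clamp_def mult_left_le_one_le inverse_le_1_iff)
qed

lemma radial_clamp_id: "0 < R \<Longrightarrow> cmod c \<le> R \<Longrightarrow> radial_clamp R c = c"
  by (simp add: radial_clamp_def max_def)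

lemma continuous_on_radial_clamp: "R > 0 \<Longrightarrow> continuous_on UNIV (radial_clamp R)"
  unfolding radial_clamp_def by (intro continuous_intros) (auto simp: max_def)

definition cutoff :: "real \<Rightarrow> 'a::real_normed_vector \<Rightarrow> real" where
  "cutoff R z = max 0 (min 1 (R + 1 - norm z))"

text \<open>
A measurable function is almost everywhere the limit of continuous functions \<open>g n\<close>, but with no
domination. Clamping the values and cutting off the support repairs that: the operation
\<open>t R\<close> below is continuous, yields a function bounded by \<open>R\<close> and vanishing outside the ball of
radius \<open>R + 1\<close>, and commutes with the limit, so that dominated convergence gives
\<open>t R (g n) \<rightarrow> t R f\<close> in \<open>L\<^sup>2\<close> for fixed \<open>R\<close>, and \<open>t R f \<rightarrow> f\<close> as \<open>R\<close> grows.
\<close>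

lemma L2_approx_continuous:
  fixes f :: "'a::euclidean_space \<Rightarrow> complex"
  assumes f: "f \<in> borel_measurable lborel" and fin: "(\<integral>\<^sup>+z. ennreal ((cmod (f z))\<^sup>2) \<partial>lborel) < \<infinity>"
    and e: "e > (0::real)"
  shows "\<exists>g R B. continuous_on UNIV g \<and> (\<forall>z. cmod (g z) \<le> B) \<and> (\<forall>z. norm z > R \<longrightarrow> g z = 0)
    \<and> (\<integral>\<^sup>+z. ennreal ((cmod (f z - g z))\<^sup>2) \<partial>lborel) \<le> ennreal e"
proof -
  note [measurable] = f
  have cutoff: "0 \<le> cutoff R z" "cutoff R z \<le> 1" "norm z > R + 1 \<Longrightarrow> cutoff R z = 0"
    "norm z \<le> R \<Longrightarrow> cutoff R z = 1" for R and z :: 'a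
    by (auto simp: cutoff_def)
  have cont_cutoff: "continuous_on UNIV (cutoff R :: 'a \<Rightarrow> real)" for R
    unfolding cutoff_def by (intro continuous_intros)
  have [measurable]: "(\<lambda>z::'a. cutoff R z) \<in> borel_measurable borel" for R
    by (rule borel_measurable_continuous_onI[OF cont_cutoff])
  define t :: "real \<Rightarrow> ('a \<Rightarrow> complex) \<Rightarrow> 'a \<Rightarrow> complex"
    where "t R h z = cutoff R z *\<^sub>R radial_clamp R (h z)" for R h z
  have [measurable]: "R > 0 \<Longrightarrow> radial_clamp R \<in> borel_measurable borel" for R
    by (rule borel_measurable_continuous_onI[OF continuous_on_radial_clamp])
  have t_le: "cmod (t R h z) \<le> R" "cmod (t R h z) \<le> cmod (h z)" if "R > 0" for R h z
    using cmod_radial_clamp_le[OF that, of "h z"] cutoff(1,2)[of R z]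
    by (auto simp: t_def mult_left_le_one_le intro: order_trans[OF mult_left_le_one_le])
  have t0: "t R h z = 0" if "norm z > R + 1" for R h z
    using cutoff(3)[OF that] by (simp add: t_def)
  \<comment> \<open>The truncations \<open>t R f\<close> converge to \<open>f\<close>, with \<open>2 |f|\<close> dominating the error.\<close>
  have "(\<lambda>k. \<integral>\<^sup>+z. ennreal ((cmod (f z - t (real (Suc k)) f z))\<^sup>2) \<partial>lborel) \<longlonglongrightarrow> (\<integral>\<^sup>+(z::'a). 0 \<partial>lborel)"
  proof (rule nn_integral_dominated_convergence[where w="\<lambda>z. 4 * ennreal ((cmod (f z))\<^sup>2)"])
    show "AE z in lborel. ennreal ((cmod (f z - t (real (Suc k)) f z))\<^sup>2) \<le> 4 * ennreal ((cmod (f z))\<^sup>2)" for k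
    proof (intro AE_I2)
      fix z
      have "cmod (f z - t (real (Suc k)) f z) \<le> 2 * cmod (f z)"
        using t_le(2)[of "real (Suc k)" f z] norm_triangle_ineq4[of "f z" "t (real (Suc k)) f z"] by auto
      then have "(cmod (f z - t (real (Suc k)) f z))\<^sup>2 \<le> 4 * (cmod (f z))\<^sup>2"
        using power_mono[of "cmod (f z - t (real (Suc k)) f z)" "2 * cmod (f z)" 2] by (simp add: power_mult_distrib)
      then show "ennreal ((cmod (f z - t (real (Suc k)) f z))\<^sup>2) \<le> 4 * ennreal ((cmod (f z))\<^sup>2)"
        by - (drule ennreal_leI, simp add: ennreal_mult')
    qed
    show "(\<integral>\<^sup>+z. 4 * ennreal ((cmod (f z))\<^sup>2) \<partial>lborel) < \<infinity>"
      using fin by (simp add: nn_integral_cmult ennreal_mult_less_top)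
    show "AE z in lborel. (\<lambda>k. ennreal ((cmod (f z - t (real (Suc k)) f z))\<^sup>2)) \<longlonglongrightarrow> 0"
    proof (intro AE_I2 tendsto_eventually)
      fix z
      have ev: "eventually (\<lambda>k. real (Suc k) \<ge> max (norm z) (cmod (f z))) sequentially"
        using filterlim_real_sequentially[unfolded filterlim_at_top, rule_format, of "max (norm z) (cmod (f z))"]
        by (rule eventually_mono) simp
      show "\<forall>\<^sub>F k in sequentially. ennreal ((cmod (f z - t (real (Suc k)) f z))\<^sup>2) = 0"
        using ev
      proof eventually_elim
        case (elim k)
        then have "t (real (Suc k)) f z = f z"
          using cutoff(4)[of z "real (Suc k)"] radial_clamp_id[of "real (Suc k)" "f z"]
          by (simp add: t_def del: of_nat_Suc)
        then show ?case by simp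
      qed
    qed
  qed (auto simp: t_def)
  then have "(\<lambda>k. \<integral>\<^sup>+z. ennreal ((cmod (f z - t (real (Suc k)) f z))\<^sup>2) \<partial>lborel) \<longlonglongrightarrow> 0" by simp
  then have "\<forall>\<^sub>F k in sequentially. (\<integral>\<^sup>+z. ennreal ((cmod (f z - t (real (Suc k)) f z))\<^sup>2) \<partial>lborel) < ennreal (e/4)"
    using e by (auto intro: order_tendstoD(2))
  then obtain k where k: "(\<integral>\<^sup>+z. ennreal ((cmod (f z - t (real (Suc k)) f z))\<^sup>2) \<partial>lborel) < ennreal (e/4)"
    by (auto simp: eventually_sequentially)
  define R where "R = real (Suc k)"
  have R: "R > 0" by (simp add: R_def)
  have "f measurable_on UNIV"
    using f by (simp add: measurable_on_iff_borel_measurable lebesgue_on_UNIV_eq measurable_completion)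
  then obtain N g where N: "negligible N" and g: "\<And>n. continuous_on UNIV (g n)"
    and lim: "\<And>x. x \<notin> N \<Longrightarrow> (\<lambda>n. g n x) \<longlonglongrightarrow> f x"
    unfolding measurable_on_def by auto
  have contt: "continuous_on UNIV (t R (g n))" for n
    unfolding t_def using continuous_on_compose2[OF continuous_on_radial_clamp[OF R] g]
    by (intro continuous_intros cont_cutoff) auto
  have tm: "t R (g n) \<in> borel_measurable lborel" for n
    using borel_measurable_continuous_onI[OF contt[of n]] by simp
  have "(\<lambda>n. \<integral>\<^sup>+z. ennreal ((cmod (t R f z - t R (g n) z))\<^sup>2) \<partial>lebesgue) \<longlonglongrightarrow> (\<integral>\<^sup>+(z::'a). 0 \<partial>lebesgue)"
  proof (rule nn_integral_dominated_convergence[where w="\<lambda>z. ennreal ((2 * R)\<^sup>2) * indicator (cball 0 (R+1)) z"])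
    show "AE z in lebesgue. ennreal ((cmod (t R f z - t R (g n) z))\<^sup>2) \<le> ennreal ((2 * R)\<^sup>2) * indicator (cball 0 (R+1)) z" for n
    proof (intro AE_I2)
      fix z
      show "ennreal ((cmod (t R f z - t R (g n) z))\<^sup>2) \<le> ennreal ((2 * R)\<^sup>2) * indicator (cball 0 (R+1)) z"
      proof (cases "norm z > R + 1")
        case True
        then show ?thesis by (simp add: t0)
      next
        case False
        have "cmod (t R f z - t R (g n) z) \<le> 2 * R"
          using t_le(1)[OF R, of f z] t_le(1)[OF R, of "g n" z] norm_triangle_ineq4[of "t R f z" "t R (g n) z"] by auto
        then have "(cmod (t R f z - t R (g n) z))\<^sup>2 \<le> (2 * R)\<^sup>2"
          by (intro power_mono) auto
        then show ?thesis using False by (simp add: ennreal_leI)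
      qed
    qed
    have "emeasure lebesgue (cball (0::'a) (R + 1)) < \<infinity>"
      using lmeasurable_cball[of "0::'a" "R+1"] by (simp add: fmeasurable_def)
    then show "(\<integral>\<^sup>+(z::'a). ennreal ((2 * R)\<^sup>2) * indicator (cball 0 (R+1)) z \<partial>lebesgue) < \<infinity>"
      by (subst nn_integral_cmult_indicator) (auto simp: ennreal_mult_less_top)
    have "AE z in lebesgue. z \<notin> N"
      using N by (simp add: negligible_iff_null_sets AE_not_in)
    then show "AE z in lebesgue. (\<lambda>n. ennreal ((cmod (t R f z - t R (g n) z))\<^sup>2)) \<longlonglongrightarrow> 0"
    proof eventually_elim
      case (elim z)
      have "(\<lambda>n. radial_clamp R (g n z)) \<longlonglongrightarrow> radial_clamp R (f z)"
        using continuous_on_tendsto_compose[OF continuous_on_radial_clamp[OF R] lim[OF elim]] by simp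
      then have "(\<lambda>n. ennreal ((cmod (t R f z - t R (g n) z))\<^sup>2)) \<longlonglongrightarrow> ennreal ((cmod (t R f z - t R f z))\<^sup>2)"
        unfolding t_def by (intro tendsto_intros)
      then show ?case by simp
    qed
    have "t R f \<in> borel_measurable borel" using R unfolding t_def by measurable
    then show "(\<lambda>z. ennreal ((cmod (t R f z - t R (g n) z))\<^sup>2)) \<in> borel_measurable lebesgue" for n
      using tm[of n] by (intro measurable_completion) measurable
    show "(\<lambda>z::'a. ennreal ((2 * R)\<^sup>2) * indicator (cball 0 (R+1)) z) \<in> borel_measurable lebesgue"
      by (intro borel_measurable_times_ennreal borel_measurable_const borel_measurable_indicator) auto
  qed auto
  then have "\<forall>\<^sub>F n in sequentially. (\<integral>\<^sup>+z. ennreal ((cmod (t R f z - t R (g n) z))\<^sup>2) \<partial>lebesgue) < ennreal (e/4)"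
    using e by (auto intro: order_tendstoD(2))
  then obtain n where n: "(\<integral>\<^sup>+z. ennreal ((cmod (t R f z - t R (g n) z))\<^sup>2) \<partial>lborel) < ennreal (e/4)"
    by (auto simp: eventually_sequentially nn_integral_completion)
  have [measurable]: "t R f \<in> borel_measurable borel" using R unfolding t_def by measurable
  note [measurable] = tm[of n]
  have "(\<integral>\<^sup>+z. ennreal ((cmod (f z - t R (g n) z))\<^sup>2) \<partial>lborel)
     \<le> (\<integral>\<^sup>+z. 2 * ennreal ((cmod (f z - t R f z))\<^sup>2) + 2 * ennreal ((cmod (t R f z - t R (g n) z))\<^sup>2) \<partial>lborel)"
  proof (intro nn_integral_mono)
    fix z
    have "(cmod (f z - t R (g n) z))\<^sup>2
        \<le> 2 * (cmod (f z - t R f z))\<^sup>2 + 2 * (cmod (t R f z - t R (g n) z))\<^sup>2"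
      using cmod_diff_square_le[of "f z - t R f z" "t R (g n) z - t R f z"]
      by (simp add: norm_minus_commute)
    then show "ennreal ((cmod (f z - t R (g n) z))\<^sup>2) \<le> 
       2 * ennreal ((cmod (f z - t R f z))\<^sup>2) + 2 * ennreal ((cmod (t R f z - t R (g n) z))\<^sup>2)"
      by - (drule ennreal_leI, simp add: ennreal_mult')
  qed
  also have "\<dots> = 2 * (\<integral>\<^sup>+z. ennreal ((cmod (f z - t R f z))\<^sup>2) \<partial>lborel) +
     2 * (\<integral>\<^sup>+z. ennreal ((cmod (t R f z - t R (g n) z))\<^sup>2) \<partial>lborel)"
    by (subst nn_integral_add, measurable) (subst nn_integral_cmult; measurable)+
  also have "\<dots> \<le> 2 * ennreal (e/4) + 2 * ennreal (e/4)"
    using k n unfolding R_def by (intro add_mono mult_left_mono) auto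
  also have "\<dots> = ennreal e"
    using e by (simp add: ennreal_mult'[symmetric] ennreal_plus[symmetric] flip: ennreal_numeral del: ennreal_plus)
  finally show ?thesis
    using contt[of n] t_le(1)[OF R] t0 by blast
qed

section \<open>Twisted Gaussian averages in \<open>L\<^sup>2\<close>\<close>

lemma nn_integral_lborel_shift:
  fixes h :: "'a::euclidean_space \<Rightarrow> ennreal"
  assumes [measurable]: "h \<in> borel_measurable borel"
  shows "(\<integral>\<^sup>+z. h (z + w) \<partial>lborel) = (\<integral>\<^sup>+z. h z \<partial>lborel)"
proof -
  have "(\<integral>\<^sup>+z. h z \<partial>lborel) = (\<integral>\<^sup>+z. h z \<partial>distr lborel borel ((+) w))"
    by (simp add: lborel_distr_plus)
  also have "\<dots> = (\<integral>\<^sup>+z. h (z + w) \<partial>lborel)"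
    by (subst nn_integral_distr) (auto simp: add.commute)
  finally show ?thesis by simp
qed

lemma cmod_sum3_square_le: "(cmod (x + y + z))\<^sup>2 \<le> 3 * (cmod x)\<^sup>2 + 3 * (cmod y)\<^sup>2 + 3 * (cmod z)\<^sup>2"
proof -
  have "(cmod (x + y + z))\<^sup>2 \<le> (cmod x + cmod y + cmod z)\<^sup>2"
    by (intro power_mono norm_triangle_le add_mono norm_triangle_ineq) auto
  then show ?thesis
    using sum_squares_bound[of "cmod x" "cmod y"] sum_squares_bound[of "cmod x" "cmod z"]
      sum_squares_bound[of "cmod z" "cmod y"] by (simp add: power2_sum algebra_simps)
qed

text \<open>
The square of the \<open>L\<^sup>2\<close> modulus of continuity of \<open>f\<close>, with the translates twisted by a unimodular
factor \<open>cis (\<theta> w z)\<close>. In the application \<open>\<theta> 0 z = 0\<close>, but \<open>\<theta> w z\<close> is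
unbounded in \<open>z\<close>, so that the twist is close to \<open>1\<close> only locally uniformly for small \<open>w\<close>.
\<close>

definition twisted_modulus ::
  "('a::euclidean_space \<Rightarrow> 'a \<Rightarrow> real) \<Rightarrow> ('a \<Rightarrow> complex) \<Rightarrow> 'a \<Rightarrow> ennreal" where
  "twisted_modulus \<theta> f w = (\<integral>\<^sup>+z. ennreal ((cmod (cis (\<theta> w z) * f (z + w) - f z))\<^sup>2) \<partial>lborel)"

lemma measurable_twist:
  fixes \<theta> :: "'a::euclidean_space \<Rightarrow> 'a \<Rightarrow> real"
  assumes "continuous_on UNIV (\<lambda>(w, z). \<theta> w z)"
  shows "(\<lambda>(w, z). cis (\<theta> w z)) \<in> borel_measurable (borel \<Otimes>\<^sub>M borel)"
  unfolding borel_prod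
  by (rule borel_measurable_continuous_onI)
    (use assms in \<open>auto simp: split_def cis_conv_exp intro!: continuous_intros\<close>)

lemma twisted_modulus_le:
  fixes \<theta> :: "'a::euclidean_space \<Rightarrow> 'a \<Rightarrow> real"
  assumes f [measurable]: "f \<in> borel_measurable borel"
  shows "twisted_modulus \<theta> f w \<le> 4 * (\<integral>\<^sup>+z. ennreal ((cmod (f z))\<^sup>2) \<partial>lborel)"
proof -
  have "twisted_modulus \<theta> f w \<le> 
    (\<integral>\<^sup>+z. 2 * ennreal ((cmod (f (z + w)))\<^sup>2) + 2 * ennreal ((cmod (f z))\<^sup>2) \<partial>lborel)"
    unfolding twisted_modulus_def
  proof (intro nn_integral_mono)
    fix z
    have "(cmod (cis (\<theta> w z) * f (z + w) - f z))\<^sup>2 \<le> 2 * (cmod (f (z + w)))\<^sup>2 + 2 * (cmod (f z))\<^sup>2"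
      using cmod_diff_square_le[of "cis (\<theta> w z) * f (z + w)" "f z"] by (simp add: norm_mult)
    then show "ennreal ((cmod (cis (\<theta> w z) * f (z + w) - f z))\<^sup>2) 
        \<le> 2 * ennreal ((cmod (f (z + w)))\<^sup>2) + 2 * ennreal ((cmod (f z))\<^sup>2)"
      by - (drule ennreal_leI, simp add: ennreal_mult')
  qed
  also have "\<dots> = 2 * (\<integral>\<^sup>+z. ennreal ((cmod (f (z + w)))\<^sup>2) \<partial>lborel) + 2 * (\<integral>\<^sup>+z. ennreal ((cmod (f z))\<^sup>2) \<partial>lborel)"
    by (simp add: nn_integral_add nn_integral_cmult)
  also have "(\<integral>\<^sup>+z. ennreal ((cmod (f (z + w)))\<^sup>2) \<partial>lborel) = (\<integral>\<^sup>+z. ennreal ((cmod (f z))\<^sup>2) \<partial>lborel)"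
    by (rule nn_integral_lborel_shift) simp
  finally show ?thesis
    by (simp flip: distrib_right)
qed

text \<open>
For \<open>g\<close> bounded, continuous and of bounded support, \<open>cis (\<theta> w z) * g (z + w) \<rightarrow> g z\<close> pointwise as
\<open>w \<rightarrow> 0\<close>, and all these functions live on one ball. Dominated convergence is a statement about
sequences, hence the argument by contradiction.
\<close>

lemma twisted_modulus_small_continuous:
  fixes \<theta> :: "'a::euclidean_space \<Rightarrow> 'a \<Rightarrow> real" and g :: "'a \<Rightarrow> complex"
  assumes \<theta>: "continuous_on UNIV (\<lambda>(w, z). \<theta> w z)" and \<theta>0: "\<And>z. \<theta> 0 z = 0"
    and g: "continuous_on UNIV g" and gB: "\<And>z. cmod (g z) \<le> B" and gR: "\<forall>z. norm z > R \<longrightarrow> g z = 0"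
    and e: "e > (0::real)"
  shows "\<exists>d>0. \<forall>w. norm w < d \<longrightarrow> twisted_modulus \<theta> g w \<le> ennreal e"
proof (rule ccontr)
  assume neg: "\<not> ?thesis"
  have "\<exists>w. norm w < 1 / real (Suc n) \<and> \<not> twisted_modulus \<theta> g w \<le> ennreal e" for n
    using neg by (metis divide_pos_pos of_nat_0_less_iff zero_less_Suc zero_less_one)
  then obtain w where w: "\<And>n. norm (w n) < 1 / real (Suc n)" 
      and big: "\<And>n. \<not> twisted_modulus \<theta> g (w n) \<le> ennreal e"
    by metis
  have w0: "w \<longlonglongrightarrow> 0"
    using w by (intro LIMSEQ_norm_0) auto
  have w1: "norm (w n) \<le> 1" for n
    using w[of n] by (smt (verit) divide_le_eq_1 of_nat_0_less_iff of_nat_1 of_nat_mono le_numeral_extra(4) Suc_leI zero_less_Suc One_nat_def)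
  have [measurable]: "g \<in> borel_measurable borel"
    by (rule borel_measurable_continuous_onI[OF g])
  note [measurable] = measurable_twist[OF \<theta>]
  have "(\<lambda>n. twisted_modulus \<theta> g (w n)) \<longlonglongrightarrow> (\<integral>\<^sup>+(z::'a). 0 \<partial>lborel)"
    unfolding twisted_modulus_def
  proof (rule nn_integral_dominated_convergence[where w="\<lambda>z. ennreal ((2 * B)\<^sup>2) * indicator (cball 0 (R+1)) z"])
    show "(\<lambda>z. ennreal ((cmod (cis (\<theta> (w n) z) * g (z + w n) - g z))\<^sup>2)) \<in> borel_measurable lborel" for n
      by measurable
    show "AE z in lborel. ennreal ((cmod (cis (\<theta> (w n) z) * g (z + w n) - g z))\<^sup>2)
       \<le> ennreal ((2 * B)\<^sup>2) * indicator (cball 0 (R+1)) z" for n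
    proof (intro AE_I2)
      fix z
      show "ennreal ((cmod (cis (\<theta> (w n) z) * g (z + w n) - g z))\<^sup>2)
         \<le> ennreal ((2 * B)\<^sup>2) * indicator (cball 0 (R+1)) z"
      proof (cases "norm z > R + 1")
        case True
        then have "norm (z + w n) > R"
          using w1[of n] norm_diff_ineq[of z "w n"] by linarith
        then have "g (z + w n) = 0" "g z = 0" using gR True by auto
        then show ?thesis by simp
      next
        case False
        have "cmod (cis (\<theta> (w n) z) * g (z + w n) - g z) \<le> 2 * B"
          using gB[of z] gB[of "z + w n"] norm_triangle_ineq4[of "cis (\<theta> (w n) z) * g (z + w n)" "g z"]
          by (simp add: norm_mult)
        then have "(cmod (cis (\<theta> (w n) z) * g (z + w n) - g z))\<^sup>2 \<le> (2 * B)\<^sup>2"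
          by (intro power_mono) auto
        then show ?thesis using False by (simp add: ennreal_leI)
      qed
    qed
    have "emeasure lborel (cball (0::'a) (R + 1)) < \<infinity>"
      using emeasure_bounded_finite[of "cball (0::'a) (R+1)"] by simp
    then show "(\<integral>\<^sup>+(z::'a). ennreal ((2 * B)\<^sup>2) * indicator (cball 0 (R+1)) z \<partial>lborel) < \<infinity>"
      by (subst nn_integral_cmult_indicator) (auto simp: ennreal_mult_less_top)
    show "AE z in lborel. (\<lambda>n. ennreal ((cmod (cis (\<theta> (w n) z) * g (z + w n) - g z))\<^sup>2)) \<longlonglongrightarrow> 0"
    proof (intro AE_I2)
      fix z :: 'a
      have "(\<lambda>n. (w n, z)) \<longlonglongrightarrow> (0, z)"
        by (intro tendsto_intros w0)
      then have "(\<lambda>n. (\<lambda>(w, z). \<theta> w z) (w n, z)) \<longlonglongrightarrow> (\<lambda>(w, z). \<theta> w z) (0, z)"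
        by (intro continuous_on_tendsto_compose[OF \<theta>]) auto
      then have t: "(\<lambda>n. cis (\<theta> (w n) z)) \<longlonglongrightarrow> cis 0"
        unfolding \<theta>0 split by (intro tendsto_cis) (simp add: \<theta>0)
      have "(\<lambda>n. z + w n) \<longlonglongrightarrow> z"
        using tendsto_add[OF tendsto_const w0, of z] by simp
      then have "(\<lambda>n. g (z + w n)) \<longlonglongrightarrow> g z"
        by (intro continuous_on_tendsto_compose[OF g]) auto
      then have "(\<lambda>n. ennreal ((cmod (cis (\<theta> (w n) z) * g (z + w n) - g z))\<^sup>2)) 
        \<longlonglongrightarrow> ennreal ((cmod (cis 0 * g z - g z))\<^sup>2)"
        by (intro tendsto_intros t)
      then show "(\<lambda>n. ennreal ((cmod (cis (\<theta> (w n) z) * g (z + w n) - g z))\<^sup>2)) \<longlonglongrightarrow> 0"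
        by simp
    qed
    show "(\<lambda>z::'a. ennreal ((2 * B)\<^sup>2) * indicator (cball 0 (R+1)) z) \<in> borel_measurable lborel"
      by (intro borel_measurable_times_ennreal borel_measurable_const borel_measurable_indicator) auto
  qed auto
  then have "\<forall>\<^sub>F n in sequentially. twisted_modulus \<theta> g (w n) < ennreal e"
    using e by (auto intro: order_tendstoD(2))
  then obtain n where "twisted_modulus \<theta> g (w n) < ennreal e"
    by (auto simp: eventually_sequentially)
  then show False
    using big[of n] by simp
qed

text \<open>
Continuity of twisted translations on \<open>L\<^sup>2\<close>: they are isometries, so the case of a continuous
\<open>g\<close> close to \<open>f\<close> suffices, at the cost of two multiples of the squared distance of \<open>f\<close> and \<open>g\<close>.
\<close>

lemma twisted_modulus_small:
  fixes \<theta> :: "'a::euclidean_space \<Rightarrow> 'a \<Rightarrow> real" and f :: "'a \<Rightarrow> complex"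
  assumes \<theta>: "continuous_on UNIV (\<lambda>(w, z). \<theta> w z)" and \<theta>0: "\<And>z. \<theta> 0 z = 0"
    and f [measurable]: "f \<in> borel_measurable borel" 
    and fin: "(\<integral>\<^sup>+z. ennreal ((cmod (f z))\<^sup>2) \<partial>lborel) < \<infinity>"
    and e: "e > (0::real)"
  shows "\<exists>d>0. \<forall>w. norm w < d \<longrightarrow> twisted_modulus \<theta> f w \<le> ennreal e"
proof -
  \<comment> \<open>Three terms, each weighted by 3, have to add up to at most \<open>e\<close>.\<close>
  obtain g R B where g: "continuous_on UNIV g" and gB: "\<And>z. cmod (g z) \<le> B" 
    and gR: "\<forall>z. norm z > R \<longrightarrow> g z = 0"
    and fg: "(\<integral>\<^sup>+z. ennreal ((cmod (f z - g z))\<^sup>2) \<partial>lborel) \<le> ennreal (e/9)"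
    using L2_approx_continuous[of f "e/9"] fin e by auto
  have [measurable]: "g \<in> borel_measurable borel"
    by (rule borel_measurable_continuous_onI[OF g])
  note [measurable] = measurable_twist[OF \<theta>]
  obtain d where d: "d > 0" "\<And>w. norm w < d \<Longrightarrow> twisted_modulus \<theta> g w \<le> ennreal (e/9)"
    using twisted_modulus_small_continuous[OF \<theta> \<theta>0 g gB gR, of "e/9"] e by auto
  have "twisted_modulus \<theta> f w \<le> ennreal e" if "norm w < d" for w
  proof -
    have "twisted_modulus \<theta> f w \<le> 
      (\<integral>\<^sup>+z. 3 * ennreal ((cmod (f (z + w) - g (z + w)))\<^sup>2) 
         + 3 * ennreal ((cmod (cis (\<theta> w z) * g (z + w) - g z))\<^sup>2)
         + 3 * ennreal ((cmod (f z - g z))\<^sup>2) \<partial>lborel)"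
      unfolding twisted_modulus_def
    proof (intro nn_integral_mono)
      fix z
      have "(cmod (cis (\<theta> w z) * f (z + w) - f z))\<^sup>2 = 
         (cmod (cis (\<theta> w z) * (f (z + w) - g (z + w)) + (cis (\<theta> w z) * g (z + w) - g z) + (g z - f z)))\<^sup>2"
        by (simp add: algebra_simps)
      also have "\<dots> \<le> 3 * (cmod (f (z + w) - g (z + w)))\<^sup>2 
         + 3 * (cmod (cis (\<theta> w z) * g (z + w) - g z))\<^sup>2 + 3 * (cmod (f z - g z))\<^sup>2"
        using cmod_sum3_square_le[of "cis (\<theta> w z) * (f (z + w) - g (z + w))" "cis (\<theta> w z) * g (z + w) - g z" "g z - f z"]
        by (simp add: norm_mult norm_minus_commute)
      finally show "ennreal ((cmod (cis (\<theta> w z) * f (z + w) - f z))\<^sup>2) 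
         \<le> 3 * ennreal ((cmod (f (z + w) - g (z + w)))\<^sup>2) 
         + 3 * ennreal ((cmod (cis (\<theta> w z) * g (z + w) - g z))\<^sup>2)
         + 3 * ennreal ((cmod (f z - g z))\<^sup>2)"
        by (subst (asm) ennreal_le_iff[symmetric]) (simp_all add: ennreal_mult')
    qed
    also have "\<dots> = 3 * (\<integral>\<^sup>+z. ennreal ((cmod (f (z + w) - g (z + w)))\<^sup>2) \<partial>lborel)
        + 3 * twisted_modulus \<theta> g w + 3 * (\<integral>\<^sup>+z. ennreal ((cmod (f z - g z))\<^sup>2) \<partial>lborel)"
      unfolding twisted_modulus_def
      by (simp add: nn_integral_add nn_integral_cmult)
    also have "(\<integral>\<^sup>+z. ennreal ((cmod (f (z + w) - g (z + w)))\<^sup>2) \<partial>lborel) = (\<integral>\<^sup>+z. ennreal ((cmod (f z - g z))\<^sup>2) \<partial>lborel)"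
      by (rule nn_integral_lborel_shift) simp
    also have "3 * \<dots> + 3 * twisted_modulus \<theta> g w + 3 * \<dots> \<le> 3 * ennreal (e/9) + 3 * ennreal (e/9) + 3 * ennreal (e/9)"
      using fg d(2)[OF that] by (intro add_mono mult_left_mono) auto
    also have "\<dots> = ennreal e"
      using e by (simp add: ennreal_mult'[symmetric] ennreal_plus[symmetric] flip: ennreal_numeral del: ennreal_plus)
    finally show ?thesis .
  qed
  then show ?thesis using d(1) by blast
qed

definition gauss_density :: "real \<Rightarrow> 'a::euclidean_space \<Rightarrow> real" where
  "gauss_density a w = exp (- a * (norm w)\<^sup>2) / sqrt (pi / a) ^ DIM('a)"

lemma gauss_density_nonneg: "a > 0 \<Longrightarrow> gauss_density a w \<ge> 0"
  by (simp add: gauss_density_def)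

lemma measurable_gauss_density [measurable]: "gauss_density a \<in> borel_measurable borel"
  unfolding gauss_density_def by measurable

lemma nn_integral_gauss_density:
  assumes "a > 0"
  shows "(\<integral>\<^sup>+(w::'a::euclidean_space). ennreal (gauss_density a w) \<partial>lborel) = 1"
proof -
  have pos: "sqrt (pi / a) ^ DIM('a) > 0" using assms by simp
  have "(\<integral>\<^sup>+(w::'a). ennreal (gauss_density a w) \<partial>lborel) 
    = (\<integral>\<^sup>+(w::'a). ennreal (1 / sqrt (pi / a) ^ DIM('a)) * ennreal (exp (- a * (norm w)\<^sup>2)) \<partial>lborel)"
    using pos by (intro nn_integral_cong) (simp add: gauss_density_def flip: ennreal_mult')
  also have "\<dots> = ennreal (1 / sqrt (pi / a) ^ DIM('a)) * ennreal (sqrt (pi / a) ^ DIM('a))"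
    by (subst nn_integral_cmult) (use nn_integral_gaussian[OF assms, where 'a='a] in auto)
  also have "\<dots> = ennreal (1 / sqrt (pi / a) ^ DIM('a) * sqrt (pi / a) ^ DIM('a))"
    using pos by (intro ennreal_mult'[symmetric]) simp
  also have "1 / sqrt (pi / a) ^ DIM('a) * sqrt (pi / a) ^ DIM('a) = 1"
    using pos by (metis divide_self_if less_irrefl times_divide_eq_left mult_1)
  finally show ?thesis by simp
qed

definition twisted_average ::
  "('a::euclidean_space \<Rightarrow> 'a \<Rightarrow> real) \<Rightarrow> real \<Rightarrow> ('a \<Rightarrow> complex) \<Rightarrow> 'a \<Rightarrow> complex" where
  "twisted_average \<theta> a f z = (LINT w|lborel. of_real (gauss_density a w) * (cis (\<theta> w z) * f (z + w)))"

lemma measurable_twisted_average: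
  fixes \<theta> :: "'a::euclidean_space \<Rightarrow> 'a \<Rightarrow> real" and f :: "'a \<Rightarrow> complex"
  assumes \<theta>: "continuous_on UNIV (\<lambda>(w, z). \<theta> w z)" and f [measurable]: "f \<in> borel_measurable borel"
  shows "twisted_average \<theta> a f \<in> borel_measurable borel"
proof -
  note [measurable] = measurable_twist[OF \<theta>]
  have "(\<lambda>(w, z). of_real (gauss_density a w) * (cis (\<theta> w z) * f (z + w))) \<in> borel_measurable (lborel \<Otimes>\<^sub>M borel)"
    by measurable
  from measurable_pair_swap[OF this]
  have "(\<lambda>(z, w). of_real (gauss_density a w) * (cis (\<theta> w z) * f (z + w))) \<in> borel_measurable (borel \<Otimes>\<^sub>M lborel)"
    by simp
  then show ?thesis
    unfolding twisted_average_def[abs_def] by (rule lborel.borel_measurable_lebesgue_integral)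
qed

lemma integrable_twisted_average:
  fixes \<theta> :: "'a::euclidean_space \<Rightarrow> 'a \<Rightarrow> real" and f :: "'a \<Rightarrow> complex"
  assumes a: "a > 0" and \<theta>: "continuous_on UNIV (\<lambda>(w, z). \<theta> w z)"
    and f [measurable]: "f \<in> borel_measurable borel" 
    and fin: "(\<integral>\<^sup>+z. ennreal ((cmod (f z))\<^sup>2) \<partial>lborel) < \<infinity>"
  shows "integrable lborel (\<lambda>w. of_real (gauss_density a w) * (cis (\<theta> w z) * f (z + w)))"
proof (rule Bochner_Integration.integrable_bound)
  note [measurable] = measurable_twist[OF \<theta>]
  define C where "C = 1 / sqrt (pi / a) ^ DIM('a)"
  have C: "C > 0" using a by (simp add: C_def)
  have "integrable lborel (\<lambda>w::'a. gauss_density a w)"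
    using nn_integral_gauss_density[OF a, where 'a='a] gauss_density_nonneg[OF a]
    by (intro integrableI_nonneg) auto
  moreover have "integrable lborel (\<lambda>w. (cmod (f (z + w)))\<^sup>2)"
    using fin nn_integral_lborel_shift[of "\<lambda>w. ennreal ((cmod (f w))\<^sup>2)" z]
    by (intro integrableI_nonneg) (auto simp: add.commute)
  ultimately show "integrable lborel (\<lambda>w. gauss_density a w + C * (cmod (f (z + w)))\<^sup>2)"
    by (intro Bochner_Integration.integrable_add integrable_mult_right)
  show "AE w in lborel. norm (of_real (gauss_density a w) * (cis (\<theta> w z) * f (z + w)))
     \<le> norm (gauss_density a w + C * (cmod (f (z + w)))\<^sup>2)"
  proof (intro AE_I2)
    fix w
    let ?x = "cmod (f (z + w))"
    have g: "0 \<le> gauss_density a w" "gauss_density a w \<le> C"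
      using a C by (auto simp: gauss_density_def C_def divide_simps)
    have "?x \<le> 1 + ?x\<^sup>2"
      using sum_squares_bound[of ?x 1] norm_ge_zero[of "f (z + w)"] unfolding mult_1_right one_power2 by linarith
    then have "gauss_density a w * ?x \<le> gauss_density a w * (1 + ?x\<^sup>2)"
      using g by (intro mult_left_mono)
    also have "\<dots> \<le> gauss_density a w + C * ?x\<^sup>2"
      using g by (simp add: algebra_simps mult_right_mono)
    finally show "norm (of_real (gauss_density a w) * (cis (\<theta> w z) * f (z + w)))
     \<le> norm (gauss_density a w + C * ?x\<^sup>2)"
      using g C by (simp add: norm_mult)
  qed
qed (use measurable_twist[OF \<theta>] in \<open>measurable\<close>)

text \<open>
The density has total mass one, so \<open>twisted_average \<theta> a f z - f z\<close> is the average over \<open>w\<close> of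
\<open>cis (\<theta> w z) * f (z + w) - f z\<close>. Jensen's inequality for the square, here as the
Cauchy-Schwarz inequality for the splitting of the density into two square roots, moves the
square inside the average, and Tonelli exchanges the two integrations.
\<close>

lemma twisted_average_diff_le:
  fixes \<theta> :: "'a::euclidean_space \<Rightarrow> 'a \<Rightarrow> real" and f :: "'a \<Rightarrow> complex"
  assumes a: "a > 0" and \<theta>: "continuous_on UNIV (\<lambda>(w, z). \<theta> w z)"
    and f [measurable]: "f \<in> borel_measurable borel" 
    and fin: "(\<integral>\<^sup>+z. ennreal ((cmod (f z))\<^sup>2) \<partial>lborel) < \<infinity>"
  shows "(\<integral>\<^sup>+z. ennreal ((cmod (twisted_average \<theta> a f z - f z))\<^sup>2) \<partial>lborel)
    \<le> (\<integral>\<^sup>+w. ennreal (gauss_density a w) * twisted_modulus \<theta> f w \<partial>lborel)"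
proof -
  note [measurable] = measurable_twist[OF \<theta>]
  note g0 = gauss_density_nonneg[OF a]
  define F where "F w z = cis (\<theta> w z) * f (z + w) - f z" for w z
  have F_meas [measurable]: "(\<lambda>(w, z). F w z) \<in> borel_measurable (borel \<Otimes>\<^sub>M borel)"
    unfolding F_def by measurable
  have g_int: "integrable lborel (\<lambda>w::'a. gauss_density a w)"
    using nn_integral_gauss_density[OF a, where 'a='a] g0
    by (intro integrableI_nonneg) auto
  have g_one: "(LINT w|lborel. gauss_density a (w::'a)) = 1"
    using nn_integral_gauss_density[OF a, where 'a='a] g0
    by (subst integral_eq_nn_integral) auto
  have pt: "ennreal ((cmod (twisted_average \<theta> a f z - f z))\<^sup>2)
     \<le> (\<integral>\<^sup>+w. ennreal (gauss_density a w) * ennreal ((cmod (F w z))\<^sup>2) \<partial>lborel)" for z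
  proof -
    have [measurable]: "(\<lambda>w. F w z) \<in> borel_measurable borel" by measurable
    have i1: "integrable lborel (\<lambda>w::'a. complex_of_real (gauss_density a w) * f z)"
      using g_int by (intro integrable_mult_left) (rule integrable_of_real)
    have "twisted_average \<theta> a f z - f z = twisted_average \<theta> a f z - (LINT w|lborel. complex_of_real (gauss_density a (w::'a)) * f z)"
      using g_int by (simp add: g_one)
    also have "\<dots> = (LINT w|lborel. of_real (gauss_density a w) * F w z)"
      unfolding twisted_average_def F_def
      by (subst Bochner_Integration.integral_diff[symmetric])
        (use integrable_twisted_average[OF a \<theta> f fin, of z] i1 in \<open>auto simp: algebra_simps\<close>)
    finally have eq: "twisted_average \<theta> a f z - f z = (LINT w|lborel. of_real (gauss_density a w) * F w z)" .
    have int: "integrable lborel (\<lambda>w. of_real (gauss_density a w) * F w z)"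
      using Bochner_Integration.integrable_diff[OF integrable_twisted_average[OF a \<theta> f fin, of z] i1]
      by (simp add: F_def algebra_simps)
    have "ennreal (cmod (twisted_average \<theta> a f z - f z)) \<le> (\<integral>\<^sup>+w. ennreal (cmod (of_real (gauss_density a w) * F w z)) \<partial>lborel)"
      unfolding eq by (rule integral_norm_bound_ennreal[OF int])
    also have "\<dots> = (\<integral>\<^sup>+w. ennreal (sqrt (gauss_density a w)) * ennreal (sqrt (gauss_density a w) * cmod (F w z)) \<partial>lborel)"
    proof (intro nn_integral_cong)
      fix w :: 'a
      have "cmod (of_real (gauss_density a w) * F w z) 
          = sqrt (gauss_density a w) * (sqrt (gauss_density a w) * cmod (F w z))"
        using g0[of w] by (simp add: norm_mult mult.assoc[symmetric])
      then show "ennreal (cmod (of_real (gauss_density a w) * F w z)) 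
          = ennreal (sqrt (gauss_density a w)) * ennreal (sqrt (gauss_density a w) * cmod (F w z))"
        using g0[of w] by (subst ennreal_mult[symmetric]) auto
    qed
    finally have "ennreal (cmod (twisted_average \<theta> a f z - f z)) ^ 2 \<le> \<dots> ^ 2"
      by (intro power_mono) auto
    also have "\<dots> \<le> (\<integral>\<^sup>+(w::'a). ennreal (sqrt (gauss_density a w)) ^ 2 \<partial>lborel)
       * (\<integral>\<^sup>+w. ennreal (sqrt (gauss_density a w) * cmod (F w z)) ^ 2 \<partial>lborel)"
      by (rule Cauchy_Schwarz_nn_integral) measurable
    also have "(\<integral>\<^sup>+(w::'a). ennreal (sqrt (gauss_density a w)) ^ 2 \<partial>lborel) = 1"
    proof -
      have "ennreal (sqrt (gauss_density a w)) ^ 2 = ennreal (gauss_density a w)" for w :: 'a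
        using g0[of w] by (simp add: ennreal_power)
      then show ?thesis
        by (simp add: nn_integral_gauss_density[OF a])
    qed
    also have "(\<integral>\<^sup>+w. ennreal (sqrt (gauss_density a w) * cmod (F w z)) ^ 2 \<partial>lborel)
       = (\<integral>\<^sup>+w. ennreal (gauss_density a w) * ennreal ((cmod (F w z))\<^sup>2) \<partial>lborel)"
    proof (intro nn_integral_cong)
      fix w :: 'a
      show "ennreal (sqrt (gauss_density a w) * cmod (F w z)) ^ 2
        = ennreal (gauss_density a w) * ennreal ((cmod (F w z))\<^sup>2)"
        using g0[of w] by (simp add: ennreal_power power_mult_distrib ennreal_mult')
    qed
    finally show ?thesis by (simp add: ennreal_power)
  qed
  have "(\<integral>\<^sup>+z. ennreal ((cmod (twisted_average \<theta> a f z - f z))\<^sup>2) \<partial>lborel)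
     \<le> (\<integral>\<^sup>+z. \<integral>\<^sup>+w. ennreal (gauss_density a w) * ennreal ((cmod (F w z))\<^sup>2) \<partial>lborel \<partial>lborel)"
    by (intro nn_integral_mono pt)
  also have "\<dots> = (\<integral>\<^sup>+w. \<integral>\<^sup>+z. ennreal (gauss_density a w) * ennreal ((cmod (F w z))\<^sup>2) \<partial>lborel \<partial>lborel)"
    by (rule lborel_pair.Fubini') measurable
  also have "\<dots> = (\<integral>\<^sup>+w. ennreal (gauss_density a w) * twisted_modulus \<theta> f w \<partial>lborel)"
    unfolding twisted_modulus_def F_def
    by (intro nn_integral_cong nn_integral_cmult) measurable
  finally show ?thesis .
qed

lemma twisted_average_diff_bounded:
  fixes \<theta> :: "'a::euclidean_space \<Rightarrow> 'a \<Rightarrow> real" and f :: "'a \<Rightarrow> complex"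
  assumes a: "a > 0" and \<theta>: "continuous_on UNIV (\<lambda>(w, z). \<theta> w z)"
    and f [measurable]: "f \<in> borel_measurable borel" 
    and fin: "(\<integral>\<^sup>+z. ennreal ((cmod (f z))\<^sup>2) \<partial>lborel) < \<infinity>"
  shows "(\<integral>\<^sup>+z. ennreal ((cmod (twisted_average \<theta> a f z - f z))\<^sup>2) \<partial>lborel)
    \<le> 4 * (\<integral>\<^sup>+z. ennreal ((cmod (f z))\<^sup>2) \<partial>lborel)" (is "_ \<le> ?N")
proof -
  have "(\<integral>\<^sup>+w. ennreal (gauss_density a w) * twisted_modulus \<theta> f w \<partial>lborel)
    \<le> (\<integral>\<^sup>+(w::'a). ennreal (gauss_density a w) * ?N \<partial>lborel)"
    by (intro nn_integral_mono mult_left_mono twisted_modulus_le f) auto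
  also have "\<dots> = ?N"
    by (simp add: nn_integral_multc nn_integral_gauss_density[OF a])
  finally show ?thesis
    using twisted_average_diff_le[OF assms] by (rule order_trans[rotated])
qed

lemma tendsto_0_if_le_ennreal:
  fixes h :: "'a \<Rightarrow> ennreal"
  assumes "\<And>e::real. e > 0 \<Longrightarrow> \<forall>\<^sub>F x in F. h x \<le> ennreal e"
  shows "(h \<longlongrightarrow> 0) F"
proof (rule order_tendstoI)
  fix b :: ennreal assume "0 < b"
  then obtain e :: real where "e > 0" "ennreal e < b"
    by (metis dense ennreal_cases ennreal_less_zero_iff not_less_iff_gr_or_eq top.not_eq_extremum)
  with assms[of e] show "\<forall>\<^sub>F x in F. h x < b"
    by (auto elim: eventually_mono intro: le_less_trans)
qed auto

text \<open>
The twisted averages are an approximate identity. The modulus is small for \<open>norm w < d\<close>.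
For \<open>norm w \<ge> d\<close> it is at most \<open>N\<close>, four times the squared norm of \<open>f\<close>, while half of the Gaussian
exponent is spent on the factor \<open>exp (- a * d\<^sup>2 / 2)\<close> and the other half
leaves the density with parameter \<open>a / 2\<close>, again of mass one.
\<close>

lemma twisted_average_tendsto:
  fixes \<theta> :: "'a::euclidean_space \<Rightarrow> 'a \<Rightarrow> real" and f :: "'a \<Rightarrow> complex"
  assumes \<theta>: "continuous_on UNIV (\<lambda>(w, z). \<theta> w z)" and \<theta>0: "\<And>z. \<theta> 0 z = 0"
    and f [measurable]: "f \<in> borel_measurable borel" 
    and fin: "(\<integral>\<^sup>+z. ennreal ((cmod (f z))\<^sup>2) \<partial>lborel) < \<infinity>"
  shows "((\<lambda>a. \<integral>\<^sup>+z. ennreal ((cmod (twisted_average \<theta> a f z - f z))\<^sup>2) \<partial>lborel) \<longlongrightarrow> 0) at_top"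
proof (rule tendsto_0_if_le_ennreal)
  fix e :: real assume e: "e > 0"
  obtain N where N: "4 * (\<integral>\<^sup>+z. ennreal ((cmod (f z))\<^sup>2) \<partial>lborel) = ennreal N" "N \<ge> 0"
    using fin by (metis ennreal_cases ennreal_mult_less_top ennreal_numeral ennreal_less_top infinity_ennreal_def less_irrefl)
  obtain d where d: "d > 0" "\<And>w. norm w < d \<Longrightarrow> twisted_modulus \<theta> f w \<le> ennreal (e/2)"
    using twisted_modulus_small[OF \<theta> \<theta>0 f fin, of "e/2"] e by auto
  \<comment> \<open>The factor \<open>sqrt 2 ^ DIM('a)\<close> is the quotient of the normalisations of the densities for \<open>a\<close> and \<open>a / 2\<close>.\<close>
  define K where "K = N * sqrt 2 ^ DIM('a)"
  have K: "K \<ge> 0" using N by (simp add: K_def)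
  have bd: "(\<integral>\<^sup>+z. ennreal ((cmod (twisted_average \<theta> a f z - f z))\<^sup>2) \<partial>lborel) \<le> ennreal (e/2 + K * exp (- a * d\<^sup>2 / 2))" 
    if a: "a > 0" for a
  proof -
    have ptw: "ennreal (gauss_density a w) * twisted_modulus \<theta> f w \<le> 
      ennreal (e/2) * ennreal (gauss_density a w) + ennreal (K * exp (- a * d\<^sup>2 / 2)) * ennreal (gauss_density (a/2) w)" for w
    proof (cases "norm w < d")
      case True
      have "ennreal (gauss_density a w) * twisted_modulus \<theta> f w \<le> ennreal (gauss_density a w) * ennreal (e/2)"
        using d(2)[OF True] by (intro mult_left_mono) auto
      then show ?thesis by (simp add: mult.commute add_increasing2)
    next
      case False
      have "gauss_density a w \<le> sqrt 2 ^ DIM('a) * exp (- a * d\<^sup>2 / 2) * gauss_density (a/2) w"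
      proof -
        have dw: "d\<^sup>2 \<le> (norm w)\<^sup>2" using False d(1) by (intro power_mono) auto
        have "exp (- a * (norm w)\<^sup>2) \<le> exp (- a * d\<^sup>2 / 2) * exp (- (a/2) * (norm w)\<^sup>2)"
          unfolding exp_add[symmetric] using dw a by (simp add: field_simps)
        moreover have "sqrt (pi / (a/2)) = sqrt 2 * sqrt (pi / a)"
          by (simp add: real_sqrt_mult[symmetric])
        ultimately show ?thesis
          unfolding gauss_density_def using a by (simp add: power_mult_distrib divide_right_mono)
      qed
      then have "gauss_density a w * N \<le> K * exp (- a * d\<^sup>2 / 2) * gauss_density (a/2) w"
        by - (drule mult_right_mono[OF _ N(2)], simp add: K_def mult_ac)
      then have *: "ennreal (gauss_density a w * N) \<le> ennreal (K * exp (- a * d\<^sup>2 / 2) * gauss_density (a/2) w)"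
        by (rule ennreal_leI)
      have "ennreal (gauss_density a w) * twisted_modulus \<theta> f w \<le> ennreal (gauss_density a w) * ennreal N"
        using twisted_modulus_le[OF f, of \<theta> w] N by (intro mult_left_mono) auto
      also have "\<dots> \<le> ennreal (K * exp (- a * d\<^sup>2 / 2)) * ennreal (gauss_density (a/2) w)"
        using * gauss_density_nonneg[OF a, of w] N K by (simp add: ennreal_mult')
      finally show ?thesis by (simp add: add_increasing)
    qed
    have "(\<integral>\<^sup>+z. ennreal ((cmod (twisted_average \<theta> a f z - f z))\<^sup>2) \<partial>lborel) \<le>
       (\<integral>\<^sup>+w. ennreal (gauss_density a w) * twisted_modulus \<theta> f w \<partial>lborel)"
      by (rule twisted_average_diff_le[OF a \<theta> f fin])
    also have "\<dots> \<le> (\<integral>\<^sup>+(w::'a). ennreal (e/2) * ennreal (gauss_density a w) + 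
        ennreal (K * exp (- a * d\<^sup>2 / 2)) * ennreal (gauss_density (a/2) w) \<partial>lborel)"
      by (intro nn_integral_mono ptw)
    also have "\<dots> = ennreal (e/2) + ennreal (K * exp (- a * d\<^sup>2 / 2))"
      using a by (simp add: nn_integral_add nn_integral_cmult nn_integral_gauss_density)
    finally show ?thesis using e K by (simp add: ennreal_plus)
  qed
  have "((\<lambda>a. e/2 + K * exp (- a * d\<^sup>2 / 2)) \<longlongrightarrow> e/2) at_top"
    using d(1) by real_asymp
  then have "\<forall>\<^sub>F a in at_top. e/2 + K * exp (- a * d\<^sup>2 / 2) < e"
    using order_tendstoD(2)[of _ "e/2" at_top e] e by simp
  then show "\<forall>\<^sub>F a in at_top. (\<integral>\<^sup>+z. ennreal ((cmod (twisted_average \<theta> a f z - f z))\<^sup>2) \<partial>lborel) \<le> ennreal e"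
    using eventually_gt_at_top[of 0]
  proof eventually_elim
    case (elim a)
    then show ?case
      using order_trans[OF bd[of a] ennreal_leI[of _ e]] by simp
  qed
qed

section \<open>Integrals with Gaussian-dominated kernels\<close>

text \<open>
Kernels \<open>k p w\<close>, with parameter \<open>p \<in> D\<close> and integration variable \<open>w\<close>, that decay like a Gaussian
locally uniformly in \<open>p\<close>. Such a bound times \<open>|f|\<close> is integrable for every square integrable \<open>f\<close>,
so it serves as the dominating function in every limit taken under the integral sign; and it
survives multiplication by the polynomials that differentiation of the kernel produces.
\<close>

definition gauss_dominated ::
  "'p::heine_borel set \<Rightarrow> ('p \<Rightarrow> 'a::euclidean_space \<Rightarrow> complex) \<Rightarrow> bool" where
  "gauss_dominated D k \<longleftrightarrow>
     continuous_on (D \<times> UNIV) (\<lambda>(p, w). k p w) \<and>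
     (\<forall>C. compact C \<and> C \<subseteq> D \<longrightarrow>
        (\<exists>a>0. \<exists>B\<ge>0. \<forall>p\<in>C. \<forall>w. cmod (k p w) \<le> B * exp (- a * (norm w)\<^sup>2)))"

lemma integrable_gaussian_mult:
  fixes f :: "'a::euclidean_space \<Rightarrow> complex"
  assumes a: "a > 0" and f: "square_integrable f"
  shows "integrable lebesgue (\<lambda>w. B * exp (- a * (norm w)\<^sup>2) * cmod (f w))"
proof -
  have [measurable]: "f \<in> borel_measurable lebesgue" and f2: "integrable lebesgue (\<lambda>z. (cmod (f z))\<^sup>2)"
    using f by (auto simp: square_integrable_def)
  have [measurable]: "(\<lambda>w::'a. exp (- a * (norm w)\<^sup>2)) \<in> borel_measurable lebesgue"
    by (intro measurable_completion) measurable
  have "integrable lebesgue (\<lambda>w. exp (- a * (norm w)\<^sup>2) * cmod (f w))"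
  proof (rule Bochner_Integration.integrable_bound)
    show "integrable lebesgue (\<lambda>w. exp (- a * (norm w)\<^sup>2) + (cmod (f w))\<^sup>2)"
      by (intro Bochner_Integration.integrable_add integrable_gaussian a f2)
    show "AE w in lebesgue. norm (exp (- a * (norm w)\<^sup>2) * cmod (f w))
        \<le> norm (exp (- a * (norm w)\<^sup>2) + (cmod (f w))\<^sup>2)"
    proof (intro AE_I2)
      fix w :: 'a
      let ?e = "exp (- a * (norm w)\<^sup>2)" and ?x = "cmod (f w)"
      have e: "?e \<le> 1" using a by simp
      have "?x \<le> 1 + ?x\<^sup>2"
        using sum_squares_bound[of ?x 1] norm_ge_zero[of "f w"] unfolding mult_1_right one_power2 by linarith
      then have "?e * ?x \<le> ?e * (1 + ?x\<^sup>2)" by (intro mult_left_mono) auto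
      also have "\<dots> \<le> ?e + ?x\<^sup>2"
        using mult_right_mono[OF e, of "?x\<^sup>2"] by (simp add: algebra_simps)
      finally show "norm (?e * ?x) \<le> norm (?e + ?x\<^sup>2)" by simp
    qed
  qed measurable
  then show ?thesis
    unfolding mult.assoc by (rule integrable_mult_right)
qed

lemma gauss_dominated_continuous_right:
  assumes "gauss_dominated D k" "p \<in> D"
  shows "continuous_on UNIV (k p)"
proof -
  have "continuous_on UNIV (\<lambda>w. (\<lambda>(p, w). k p w) (p, w))"
  proof (rule continuous_on_compose2[of "D \<times> UNIV"])
    show "continuous_on (D \<times> UNIV) (\<lambda>(p, w). k p w)"
      using assms(1) by (simp add: gauss_dominated_def)
  qed (use assms(2) in \<open>auto intro: continuous_on_Pair continuous_on_const continuous_on_id\<close>)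
  then show ?thesis by simp
qed

lemma gauss_dominated_measurable:
  assumes "gauss_dominated D k" "p \<in> D" and f: "square_integrable f"
  shows "(\<lambda>w. k p w * f w) \<in> borel_measurable lebesgue"
proof -
  have "k p \<in> borel_measurable lebesgue"
    using borel_measurable_continuous_onI[OF gauss_dominated_continuous_right[OF assms(1,2)]]
    by (intro measurable_completion) simp
  then show ?thesis using f by (auto simp: square_integrable_def)
qed

lemma gauss_dominated_bound:
  assumes "gauss_dominated D k" "compact C" "C \<subseteq> D"
  obtains a B where "a > 0" "B \<ge> 0" "\<And>p w. p \<in> C \<Longrightarrow> cmod (k p w) \<le> B * exp (- a * (norm w)\<^sup>2)"
proof -
  have "\<exists>a>0. \<exists>B\<ge>0. \<forall>p\<in>C. \<forall>w. cmod (k p w) \<le> B * exp (- a * (norm w)\<^sup>2)"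
    using assms by (simp add: gauss_dominated_def)
  then show thesis
    using that by (elim exE conjE) simp
qed

lemma gauss_dominated_integrable:
  assumes k: "gauss_dominated D k" and p: "p \<in> D" and f: "square_integrable f"
  shows "integrable lebesgue (\<lambda>w. k p w * f w)"
proof -
  obtain a B where "a > 0" and B: "\<And>w. cmod (k p w) \<le> B * exp (- a * (norm w)\<^sup>2)"
    using gauss_dominated_bound[OF k, of "{p}"] p by (metis compact_insert compact_empty empty_subsetI insert_subset insertI1)
  show ?thesis
  proof (rule Bochner_Integration.integrable_bound[OF integrable_gaussian_mult[OF \<open>a > 0\<close> f]])
    show "AE w in lebesgue. norm (k p w * f w) \<le> norm (B * exp (- a * (norm w)\<^sup>2) * cmod (f w))"
    proof (intro AE_I2)
      fix w
      have "norm (k p w * f w) \<le> B * exp (- a * (norm w)\<^sup>2) * cmod (f w)"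
        using B[of w] by (simp add: norm_mult mult_right_mono)
      then show "norm (k p w * f w) \<le> norm (B * exp (- a * (norm w)\<^sup>2) * cmod (f w))" by simp
    qed
  qed (rule gauss_dominated_measurable[OF k p f])
qed

text \<open>
A convergent sequence with its limit is compact, so one Gaussian dominates along the sequence.
\<close>

lemma gauss_dominated_continuous_integral:
  assumes k: "gauss_dominated D k" and f: "square_integrable f"
  shows "continuous_on D (\<lambda>p. LINT w|lebesgue. k p w * f w)"
  unfolding continuous_on_sequentially
proof (intro allI ballI impI, elim conjE)
  fix X p assume p: "p \<in> D" and X: "\<forall>n. X n \<in> D" "X \<longlonglongrightarrow> p"
  have "compact (insert p (range X))"
    by (rule compact_sequence_with_limit[OF X(2)])
  moreover have "insert p (range X) \<subseteq> D" using p X by auto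
  ultimately obtain a B where "a > 0" "B \<ge> 0"
    and B: "\<And>q w. q \<in> insert p (range X) \<Longrightarrow> cmod (k q w) \<le> B * exp (- a * (norm w)\<^sup>2)"
    by (rule gauss_dominated_bound[OF k]) blast
  have "(\<lambda>n. LINT w|lebesgue. k (X n) w * f w) \<longlonglongrightarrow> (LINT w|lebesgue. k p w * f w)"
  proof (rule integral_dominated_convergence[OF _ _ integrable_gaussian_mult[OF \<open>a > 0\<close> f]])
    show "(\<lambda>w. k p w * f w) \<in> borel_measurable lebesgue" 
      "\<And>n. (\<lambda>w. k (X n) w * f w) \<in> borel_measurable lebesgue"
      using X p by (auto intro: gauss_dominated_measurable[OF k _ f])
    show "AE w in lebesgue. norm (k (X n) w * f w) \<le> B * exp (- a * (norm w)\<^sup>2) * cmod (f w)" for n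
      using B[of "X n"] by (intro AE_I2) (simp add: norm_mult mult_right_mono)
    show "AE w in lebesgue. (\<lambda>n. k (X n) w * f w) \<longlonglongrightarrow> k p w * f w"
    proof (intro AE_I2 tendsto_mult tendsto_const)
      fix w :: 'b
      have "(\<lambda>n. (X n, w)) \<longlonglongrightarrow> (p, w)" by (intro tendsto_intros X)
      then have "(\<lambda>n. (\<lambda>(p, w). k p w) (X n, w)) \<longlonglongrightarrow> (\<lambda>(p, w). k p w) (p, w)"
      proof (rule continuous_on_tendsto_compose[of "D \<times> UNIV" "\<lambda>(p, w). k p w", rotated])
        show "continuous_on (D \<times> UNIV) (\<lambda>(p, w). k p w)"
          using k by (simp add: gauss_dominated_def)
      qed (use p X in auto)
      then show "(\<lambda>n. k (X n) w) \<longlonglongrightarrow> k p w" by simp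
    qed
  qed
  then show "((\<lambda>p. LINT w|lebesgue. k p w * f w) \<circ> X) \<longlonglongrightarrow> (LINT w|lebesgue. k p w * f w)"
    by (simp add: o_def)
qed

text \<open>
Differentiation under the integral sign along a path \<open>\<pi>\<close> in the parameter space. The same
statement serves the time derivative (\<open>\<pi> t = (t, z)\<close>) and all directional derivatives
(\<open>\<pi> t = (s, z + t *\<^sub>R e)\<close>). By the mean value inequality, the error of the linearisation of the
kernel is at most \<open>|t - t0|\<close> times twice a Gaussian bound for \<open>k'\<close> on the compact image of the path.
\<close>

lemma gauss_dominated_has_vector_derivative:
  fixes \<pi> :: "real \<Rightarrow> 'p::heine_borel" and k k' :: "'p \<Rightarrow> 'a::euclidean_space \<Rightarrow> complex"
  assumes k: "gauss_dominated D k" and k': "gauss_dominated D k'" and f: "square_integrable f"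
    and d: "d > 0" and \<pi>: "continuous_on (cball t0 d) \<pi>" "\<pi> ` cball t0 d \<subseteq> D"
    and deriv: "\<And>t w. t \<in> cball t0 d \<Longrightarrow> ((\<lambda>t. k (\<pi> t) w) has_vector_derivative k' (\<pi> t) w) (at t)"
  shows "((\<lambda>t. LINT w|lebesgue. k (\<pi> t) w * f w) has_vector_derivative
           (LINT w|lebesgue. k' (\<pi> t0) w * f w)) (at t0)"
proof -
  let ?I = "\<lambda>t. LINT w|lebesgue. k (\<pi> t) w * f w" and ?I' = "LINT w|lebesgue. k' (\<pi> t0) w * f w"
  let ?S = "ball t0 d"
  have t0: "t0 \<in> cball t0 d" using d by simp
  have "compact (\<pi> ` cball t0 d)" using \<pi>(1) by (intro compact_continuous_image) auto
  then obtain a B where "a > 0" "B \<ge> 0" 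
    and B: "\<And>q w. q \<in> \<pi> ` cball t0 d \<Longrightarrow> cmod (k' q w) \<le> B * exp (- a * (norm w)\<^sup>2)"
    by (rule gauss_dominated_bound[OF k' _ \<pi>(2)]) blast
  have lin: "cmod (k (\<pi> t) w - k (\<pi> t0) w - (t - t0) *\<^sub>R k' (\<pi> t0) w) \<le> \<bar>t - t0\<bar> * (2 * B * exp (- a * (norm w)\<^sup>2))"
    if "t \<in> ?S" for t w
  proof -
    have "norm ((\<lambda>t. k (\<pi> t) w) t - (\<lambda>t. k (\<pi> t) w) t0 - (t - t0) *\<^sub>R k' (\<pi> t0) w) \<le> norm (t - t0) * (2 * B * exp (- a * (norm w)\<^sup>2))"
    proof (rule vector_differentiable_bound_linearization[where S="cball t0 d" and f'="\<lambda>t. k' (\<pi> t) w"])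
      show "closed_segment t0 t \<subseteq> cball t0 d"
        using that d by (intro closed_segment_subset) auto
      show "norm (k' (\<pi> x) w - k' (\<pi> t0) w) \<le> 2 * B * exp (- a * (norm w)\<^sup>2)" if "x \<in> cball t0 d" for x
        using B[OF imageI[OF that], of w] B[OF imageI[OF t0], of w]
          norm_triangle_ineq4[of "k' (\<pi> x) w" "k' (\<pi> t0) w"] by simp
      show "((\<lambda>t. k (\<pi> t) w) has_vector_derivative k' (\<pi> x) w) (at x within cball t0 d)" if "x \<in> cball t0 d" for x
        by (rule has_vector_derivative_at_within[OF deriv[OF that]])
    qed (rule t0)
    then show ?thesis by simp
  qed
  have quot: "(\<lambda>n. (1 / norm (X n - t0)) *\<^sub>R (?I (X n) - (?I t0 + (X n - t0) *\<^sub>R ?I'))) \<longlonglongrightarrow> 0"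
    if X: "\<forall>n. X n \<in> ?S - {t0}" "X \<longlonglongrightarrow> t0" for X
  proof -
    define Q where "Q n w = (1 / norm (X n - t0)) *\<^sub>R (k (\<pi> (X n)) w - (k (\<pi> t0) w + (X n - t0) *\<^sub>R k' (\<pi> t0) w))" for n w
    have mem: "\<pi> (X n) \<in> D" "\<pi> t0 \<in> D" "X n \<in> ?S" "X n \<noteq> t0" for n
      using X(1)[rule_format, of n] \<pi>(2) t0 by (auto simp: image_subset_iff)
    note int = gauss_dominated_integrable[OF k mem(1) f] gauss_dominated_integrable[OF k mem(2) f]
      gauss_dominated_integrable[OF k' mem(2) f]
    have Q_eq: "Q n w * f w = (1 / norm (X n - t0)) *\<^sub>R 
        (k (\<pi> (X n)) w * f w - (k (\<pi> t0) w * f w + (X n - t0) *\<^sub>R (k' (\<pi> t0) w * f w)))" for n w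
      by (simp add: Q_def algebra_simps)
    have Q_int: "integrable lebesgue (\<lambda>w. Q n w * f w)" for n
      unfolding Q_eq by (intro integrable_scaleR_right Bochner_Integration.integrable_diff Bochner_Integration.integrable_add int)
    have "(1 / norm (X n - t0)) *\<^sub>R (?I (X n) - (?I t0 + (X n - t0) *\<^sub>R ?I')) = (LINT w|lebesgue. Q n w * f w)" for n
      unfolding Q_eq using int(1)[of n] int(2,3) by simp
    moreover have "(\<lambda>n. LINT w|lebesgue. Q n w * f w) \<longlonglongrightarrow> (integral\<^sup>L lebesgue (\<lambda>w::'a. 0))"
    proof (rule integral_dominated_convergence[OF _ _ integrable_gaussian_mult[OF \<open>a > 0\<close> f, of "2 * B"]])
      show "AE w in lebesgue. norm (Q n w * f w) \<le> 2 * B * exp (- a * (norm w)\<^sup>2) * cmod (f w)" for n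
      proof (intro AE_I2)
        fix w
        have "norm (Q n w) \<le> 2 * B * exp (- a * (norm w)\<^sup>2)"
          using lin[OF mem(3)[of n], of w] mem(4)[of n] by (simp add: Q_def divide_simps diff_diff_eq mult.commute)
        then show "norm (Q n w * f w) \<le> 2 * B * exp (- a * (norm w)\<^sup>2) * cmod (f w)"
          by (simp add: norm_mult mult_right_mono)
      qed
      show "AE w in lebesgue. (\<lambda>n. Q n w * f w) \<longlonglongrightarrow> 0"
      proof (intro AE_I2 tendsto_mult_left_zero)
        fix w
        have "((\<lambda>t. (1 / norm (t - t0)) *\<^sub>R (k (\<pi> t) w - (k (\<pi> t0) w + (t - t0) *\<^sub>R k' (\<pi> t0) w))) \<longlongrightarrow> 0) (at t0)"
          using deriv[OF t0, of w] by (simp add: has_vector_derivative_def has_derivative_within)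
        moreover have "filterlim X (at t0) sequentially"
          using X by (auto simp: filterlim_at)
        ultimately show "(\<lambda>n. Q n w) \<longlonglongrightarrow> 0"
          unfolding Q_def by (rule filterlim_compose)
      qed
    qed (use Q_int in auto)
    ultimately show ?thesis by simp
  qed
  have "((\<lambda>t. (1 / norm (t - t0)) *\<^sub>R (?I t - (?I t0 + (t - t0) *\<^sub>R ?I'))) \<longlongrightarrow> 0) (at t0 within ?S)"
    unfolding tendsto_at_iff_sequentially using quot by (simp add: o_def)
  then have "(?I has_vector_derivative ?I') (at t0 within ?S)"
    by (simp add: has_vector_derivative_def has_derivative_within bounded_linear_scaleR_left)
  then show ?thesis
    using d by (simp add: at_within_open[of t0 ?S])
qed

text \<open>
A factor of quadratic growth in \<open>w\<close> costs half of the exponent: \<open>1 + x \<le> (1 + 2 / a) * exp (a / 2 * x)\<close>.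
\<close>

lemma gauss_dominated_mult:
  fixes k q :: "'p::heine_borel \<Rightarrow> 'a::euclidean_space \<Rightarrow> complex"
  assumes k: "gauss_dominated D k"
    and q: "continuous_on (D \<times> UNIV) (\<lambda>(p, w). q p w)"
    and b: "continuous_on D b" and qb: "\<And>p w. p \<in> D \<Longrightarrow> cmod (q p w) \<le> b p * (1 + (norm w)\<^sup>2)"
  shows "gauss_dominated D (\<lambda>p w. q p w * k p w)"
  unfolding gauss_dominated_def
proof (intro conjI allI impI)
  show "continuous_on (D \<times> UNIV) (\<lambda>(p, w). q p w * k p w)"
    using continuous_on_mult[OF q, of "\<lambda>(p, w). k p w"] k by (auto simp: gauss_dominated_def split_def)
next
  fix C assume C: "compact C \<and> C \<subseteq> D"
  then have "compact C" "C \<subseteq> D" by auto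
  then obtain a B where a: "a > 0" and "B \<ge> 0" and B: "\<And>p w. p \<in> C \<Longrightarrow> cmod (k p w) \<le> B * exp (- a * (norm w)\<^sup>2)"
    by (rule gauss_dominated_bound[OF k]) blast
  have "compact (b ` C)"
    using C b by (intro compact_continuous_image) (auto intro: continuous_on_subset)
  then obtain M where M: "\<And>p. p \<in> C \<Longrightarrow> \<bar>b p\<bar> \<le> M"
    using compact_imp_bounded[of "b ` C"] by (auto simp: bounded_iff)
  have key: "cmod (q p w * k p w) \<le> \<bar>M\<bar> * (1 + 2 / a) * B * exp (- (a/2) * (norm w)\<^sup>2)"
    if p: "p \<in> C" for p and w :: 'a
  proof -
    let ?x = "(norm w)\<^sup>2"
    have "?x \<le> 2 / a * exp (a / 2 * ?x)"
      using exp_ge_add_one_self[of "a / 2 * ?x"] a by (simp add: field_simps)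
    moreover have "1 \<le> exp (a / 2 * ?x)" using a by simp
    ultimately have poly: "1 + ?x \<le> (1 + 2 / a) * exp (a / 2 * ?x)"
      unfolding distrib_right mult_1_left by linarith
    have "cmod (q p w) \<le> b p * (1 + ?x)" using qb C p by auto
    also have "\<dots> \<le> \<bar>M\<bar> * (1 + ?x)"
      using M[OF p] by (intro mult_right_mono) auto
    also have "\<dots> \<le> \<bar>M\<bar> * ((1 + 2 / a) * exp (a / 2 * ?x))"
      by (intro mult_left_mono poly) auto
    finally have "cmod (q p w) * cmod (k p w) \<le> \<bar>M\<bar> * ((1 + 2 / a) * exp (a / 2 * ?x)) * (B * exp (- a * ?x))"
      using B[OF p, of w] by (intro mult_mono) (use a in auto)
    also have "\<dots> = \<bar>M\<bar> * (1 + 2 / a) * B * (exp (a / 2 * ?x) * exp (- a * ?x))"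
      by (simp only: mult_ac)
    also have "exp (a / 2 * ?x) * exp (- a * ?x) = exp (- (a/2) * ?x)"
      unfolding exp_add[symmetric] by (simp add: field_simps)
    finally show ?thesis
      by (simp add: norm_mult)
  qed
  have "a / 2 > 0" "\<bar>M\<bar> * (1 + 2 / a) * B \<ge> 0" using a \<open>B \<ge> 0\<close> by auto
  with key show "\<exists>a>0. \<exists>B\<ge>0. \<forall>p\<in>C. \<forall>w. cmod (q p w * k p w) \<le> B * exp (- a * (norm w)\<^sup>2)"
    by meson
qed

section \<open>The heat kernel and its derivatives\<close>

lemma tau_csch_pos: "s > 0 \<Longrightarrow> tau_csch \<tau> s > 0"
  unfolding tau_csch_def
  by (auto simp: zero_less_divide_iff zero_less_mult_iff mult_less_0_iff)

lemma tau_coth_eq: "tau_coth \<tau> s = tau_csch \<tau> s * cosh (s * \<tau> / 4)"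
  by (simp add: tau_coth_def tau_csch_def)

lemma tau_coth_pos: "s > 0 \<Longrightarrow> tau_coth \<tau> s > 0"
  by (simp add: tau_coth_eq tau_csch_pos)

lemma sinh_ne_0:
  assumes "s > (0::real)" "\<tau> \<noteq> 0"
  shows "sinh (s * \<tau> / 4) \<noteq> 0"
  using assms by simp

text \<open>
The three identities for \<open>c = tau_coth \<tau>\<close> and \<open>S = tau_csch \<tau>\<close> behind the heat equation are
\<open>c\<^sup>2 - \<tau>\<^sup>2 = S\<^sup>2\<close>, \<open>S' = - S c / 4\<close> and \<open>c' = - S\<^sup>2 / 4\<close>. They hold for \<open>\<tau> = 0\<close> as well, so that
nothing after them distinguishes that case until the limit \<open>s \<rightarrow> 0\<close>.
\<close>

lemma tau_coth_sq_minus: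
  assumes "s > 0"
  shows "(tau_coth \<tau> s)\<^sup>2 - \<tau>\<^sup>2 = (tau_csch \<tau> s)\<^sup>2"
proof (cases "\<tau> = 0")
  case True
  then show ?thesis by (simp add: tau_coth_def tau_csch_def)
next
  case False
  define u where "u = s * \<tau> / 4"
  have "(cosh u)\<^sup>2 = 1 + (sinh u)\<^sup>2"
    using hyperbolic_pythagoras[of u] by simp
  moreover have "sinh u \<noteq> 0"
    unfolding u_def by (rule sinh_ne_0[OF assms False])
  ultimately show ?thesis
    using False unfolding tau_coth_def tau_csch_def u_def[symmetric]
    by (simp add: power_mult_distrib power_divide field_simps)
qed

lemma tau_csch_deriv:
  assumes "s > 0"
  shows "(tau_csch \<tau> has_real_derivative - (tau_csch \<tau> s * tau_coth \<tau> s / 4)) (at s)"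
proof (cases "\<tau> = 0")
  case True
  have "((\<lambda>s. 4 / s) has_real_derivative - (4 / s * (4 / s) / 4)) (at s)"
    using assms by (auto intro!: derivative_eq_intros simp: field_simps power2_eq_square)
  moreover have "tau_csch \<tau> = (\<lambda>s. 4 / s)" using True by (simp add: tau_csch_def fun_eq_iff)
  ultimately show ?thesis using True by (simp add: tau_coth_def)
next
  case False
  have "((\<lambda>s. \<tau> / sinh (s * \<tau> / 4)) has_real_derivative
      - (\<tau> / sinh (s * \<tau> / 4) * (\<tau> * (cosh (s * \<tau> / 4) / sinh (s * \<tau> / 4))) / 4)) (at s)"
    using sinh_ne_0[OF assms False]
    by (auto intro!: derivative_eq_intros simp: field_simps power2_eq_square)
  moreover have "tau_csch \<tau> = (\<lambda>s. \<tau> / sinh (s * \<tau> / 4))" using False by (simp add: tau_csch_def fun_eq_iff)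
  ultimately show ?thesis using False by (simp add: tau_coth_def)
qed

lemma tau_coth_deriv:
  assumes "s > 0"
  shows "(tau_coth \<tau> has_real_derivative - ((tau_csch \<tau> s)\<^sup>2 / 4)) (at s)"
proof -
  have d: "((\<lambda>s. tau_csch \<tau> s * cosh (s * \<tau> / 4)) has_real_derivative
     - (tau_csch \<tau> s * tau_coth \<tau> s / 4) * cosh (s * \<tau> / 4) + tau_csch \<tau> s * (sinh (s * \<tau> / 4) * (\<tau> / 4))) (at s)"
    by (auto intro!: derivative_eq_intros tau_csch_deriv[OF assms])
  have "tau_csch \<tau> s * (sinh (s * \<tau> / 4) * (\<tau> / 4)) = \<tau>\<^sup>2 / 4"
    using sinh_ne_0[OF assms, of \<tau>] by (simp add: tau_csch_def power2_eq_square)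
  moreover have "- (tau_csch \<tau> s * tau_coth \<tau> s / 4) * cosh (s * \<tau> / 4) = - ((tau_coth \<tau> s)\<^sup>2 / 4)"
    by (simp add: tau_coth_eq power2_eq_square)
  ultimately have "- (tau_csch \<tau> s * tau_coth \<tau> s / 4) * cosh (s * \<tau> / 4) + tau_csch \<tau> s * (sinh (s * \<tau> / 4) * (\<tau> / 4))
     = - ((tau_csch \<tau> s)\<^sup>2 / 4)"
    using tau_coth_sq_minus[OF assms, of \<tau>] by linarith
  with d have "((\<lambda>s. tau_csch \<tau> s * cosh (s * \<tau> / 4)) has_real_derivative - ((tau_csch \<tau> s)\<^sup>2 / 4)) (at s)"
    by (rule DERIV_cong)
  moreover have "tau_coth \<tau> = (\<lambda>s. tau_csch \<tau> s * cosh (s * \<tau> / 4))"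
    by (simp add: tau_coth_eq fun_eq_iff)
  ultimately show ?thesis by simp
qed

lemma continuous_on_tau_csch: "continuous_on {0<..} (tau_csch \<tau>)"
  by (rule DERIV_continuous_on[where D="\<lambda>s. - (tau_csch \<tau> s * tau_coth \<tau> s / 4)"])
    (auto intro: has_field_derivative_at_within tau_csch_deriv)

lemma continuous_on_tau_coth: "continuous_on {0<..} (tau_coth \<tau>)"
  by (rule DERIV_continuous_on[where D="\<lambda>s. - ((tau_csch \<tau> s)\<^sup>2 / 4)"])
    (auto intro: has_field_derivative_at_within tau_coth_deriv)

lemma continuous_on_tau [continuous_intros]:
  assumes "continuous_on S g" "\<And>x. x \<in> S \<Longrightarrow> g x > 0"
  shows "continuous_on S (\<lambda>x. tau_csch \<tau> (g x))" "continuous_on S (\<lambda>x. tau_coth \<tau> (g x))"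
  using assms
  by (auto intro: continuous_on_compose2[OF continuous_on_tau_csch]
      continuous_on_compose2[OF continuous_on_tau_coth])

type_synonym 'n phase_space = "(real^'n) \<times> (real^'n)"

text \<open>
Grouping the variables into a parameter \<open>(s, z)\<close> and an integration variable \<open>w\<close> gives the kernel
the shape to which \<open>gauss_dominated\<close> applies.
\<close>

definition kernel_at ::
  "complex \<Rightarrow> real \<Rightarrow> real \<times> 'n::finite phase_space \<Rightarrow> 'n phase_space \<Rightarrow> complex" where
  "kernel_at \<gamma> \<tau> p w = heat_kernel \<gamma> \<tau> (fst p) (fst (snd p)) (snd (snd p)) (fst w) (snd w)"

lemma heat_integral_eq:
  "heat_integral \<gamma> \<tau> f s z = (LINT w|lebesgue. kernel_at \<gamma> \<tau> (s, z) w * f w)"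
  by (simp add: heat_integral_def kernel_at_def split_def)

definition phase_form :: "'n::finite phase_space \<Rightarrow> 'n phase_space \<Rightarrow> real" where
  "phase_form z w = (fst z - fst w) \<bullet> (snd z + snd w)"

lemma kernel_at_alt:
  "kernel_at \<gamma> \<tau> (s, z) w =
     of_real ((tau_csch \<tau> s / (4 * pi)) ^ CARD('n))
     * exp (- \<gamma> * of_real (s * \<tau> / 4) - of_real (tau_coth \<tau> s / 4 * (norm (z - w))\<^sup>2)
        - \<i> * of_real (\<tau> / 2 * phase_form z w))"
  for z w :: "'n::finite phase_space"
proof -
  have n: "(norm (z - w))\<^sup>2 = (norm (fst z - fst w))\<^sup>2 + (norm (snd z - snd w))\<^sup>2"
    by (simp add: norm_prod_def)
  have split: "C * exp a * exp (- b - c) = C * exp (a - b - c)" for a b c C :: complex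
  proof -
    have "a - b - c = a + (- b - c)" by simp
    then show ?thesis by (simp only: exp_add mult.assoc)
  qed
  show ?thesis
    unfolding kernel_at_def heat_kernel_def n phase_form_def fst_conv snd_conv split power_divide ..
qed

text \<open>
The kernel is an amplitude times the exponential of a polynomial in the space variables. Its first
derivatives are therefore the kernel times a logarithmic derivative, namely \<open>log_dir\<close>
in the direction \<open>e\<close> and \<open>log_time\<close> in \<open>s\<close>; \<open>log_dir2\<close> is the derivative of \<open>log_dir\<close>
in a second direction \<open>e'\<close>, and \<open>phase_form_deriv\<close> is the derivative of \<open>phase_form\<close> in its first
argument.
\<close>

definition phase_form_deriv :: "'n::finite phase_space \<Rightarrow> 'n phase_space \<Rightarrow> 'n phase_space \<Rightarrow> real" where
  "phase_form_deriv e z w = fst e \<bullet> (snd z + snd w) + (fst z - fst w) \<bullet> snd e"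

definition log_dir ::
  "real \<Rightarrow> 'n::finite phase_space \<Rightarrow> real \<times> 'n phase_space \<Rightarrow> 'n phase_space \<Rightarrow> complex" where
  "log_dir \<tau> e p w = - of_real (tau_coth \<tau> (fst p) / 2 * ((snd p - w) \<bullet> e))
     - \<i> * of_real (\<tau> / 2 * phase_form_deriv e (snd p) w)"

definition log_dir2 ::
  "real \<Rightarrow> 'n::finite phase_space \<Rightarrow> 'n phase_space \<Rightarrow> real \<times> 'n phase_space \<Rightarrow> complex" where
  "log_dir2 \<tau> e e' p = - of_real (tau_coth \<tau> (fst p) / 2 * (e' \<bullet> e))
     - \<i> * of_real (\<tau> / 2 * (fst e \<bullet> snd e' + fst e' \<bullet> snd e))"

definition log_time ::
  "complex \<Rightarrow> real \<Rightarrow> real \<times> 'n::finite phase_space \<Rightarrow> 'n phase_space \<Rightarrow> complex" where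
  "log_time \<gamma> \<tau> p w = of_real ((tau_csch \<tau> (fst p))\<^sup>2 / 16 * (norm (snd p - w))\<^sup>2 - CARD('n) * tau_coth \<tau> (fst p) / 4)
     - \<gamma> * of_real (\<tau> / 4)"

lemma has_vector_derivative_exp:
  fixes \<phi> :: "real \<Rightarrow> complex"
  assumes "(\<phi> has_vector_derivative \<phi>') (at t)"
  shows "((\<lambda>t. exp (\<phi> t)) has_vector_derivative \<phi>' * exp (\<phi> t)) (at t)"
  using field_vector_diff_chain_at[OF assms, of exp "exp (\<phi> t)"] DERIV_exp[of "\<phi> t"]
  by (simp add: o_def)

lemma kernel_dir_deriv:
  fixes z w e :: "'n::finite phase_space"
  shows
  "((\<lambda>t. kernel_at \<gamma> \<tau> (s, z + t *\<^sub>R e) w) has_vector_derivative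
     log_dir \<tau> e (s, z + t *\<^sub>R e) w * kernel_at \<gamma> \<tau> (s, z + t *\<^sub>R e) w) (at t)"
proof -
  have sq: "(norm (z + t *\<^sub>R e - w))\<^sup>2 = (norm (z - w))\<^sup>2 + 2 * t * ((z - w) \<bullet> e) + t\<^sup>2 * (e \<bullet> e)" for t
    unfolding power2_norm_eq_inner
    by (simp add: inner_add_left inner_add_right inner_diff_left inner_diff_right inner_commute power2_eq_square algebra_simps)
  have sy: "phase_form (z + t *\<^sub>R e) w = phase_form z w + t * phase_form_deriv e z w + t\<^sup>2 * (fst e \<bullet> snd e)" for t
    by (simp add: phase_form_def phase_form_deriv_def inner_add_left inner_add_right inner_diff_left inner_diff_right inner_commute power2_eq_square algebra_simps)
  have d1: "((\<lambda>t. tau_coth \<tau> s / 4 * (norm (z + t *\<^sub>R e - w))\<^sup>2) has_real_derivative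
      tau_coth \<tau> s / 2 * ((z + t *\<^sub>R e - w) \<bullet> e)) (at t)"
    unfolding sq by (auto intro!: derivative_eq_intros simp: inner_add_left inner_diff_left algebra_simps)
  have d2: "((\<lambda>t. \<tau> / 2 * phase_form (z + t *\<^sub>R e) w) has_real_derivative
      \<tau> / 2 * phase_form_deriv e (z + t *\<^sub>R e) w) (at t)"
    unfolding sy by (auto intro!: derivative_eq_intros
        simp: phase_form_deriv_def inner_add_left inner_add_right inner_commute algebra_simps)
  have "((\<lambda>t. - \<gamma> * of_real (s * \<tau> / 4) - of_real (tau_coth \<tau> s / 4 * (norm (z + t *\<^sub>R e - w))\<^sup>2)
        - \<i> * of_real (\<tau> / 2 * phase_form (z + t *\<^sub>R e) w)) has_vector_derivative
       0 - of_real (tau_coth \<tau> s / 2 * ((z + t *\<^sub>R e - w) \<bullet> e)) - \<i> * of_real (\<tau> / 2 * phase_form_deriv e (z + t *\<^sub>R e) w)) (at t)"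
    by (intro has_vector_derivative_diff has_vector_derivative_const has_vector_derivative_mult_right
        has_vector_derivative_of_real d1 d2)
  then have "((\<lambda>t. - \<gamma> * of_real (s * \<tau> / 4) - of_real (tau_coth \<tau> s / 4 * (norm (z + t *\<^sub>R e - w))\<^sup>2)
        - \<i> * of_real (\<tau> / 2 * phase_form (z + t *\<^sub>R e) w)) has_vector_derivative
       log_dir \<tau> e (s, z + t *\<^sub>R e) w) (at t)"
    by (simp add: log_dir_def)
  from has_vector_derivative_mult_right[OF has_vector_derivative_exp[OF this],
      of "of_real ((tau_csch \<tau> s / (4 * pi)) ^ CARD('n))"]
  show ?thesis
    unfolding kernel_at_alt by (rule has_vector_derivative_eq_rhs[OF _ mult.left_commute])
qed

lemma kernel_dir_deriv2:
  "((\<lambda>t. log_dir \<tau> e (s, z + t *\<^sub>R e') w * kernel_at \<gamma> \<tau> (s, z + t *\<^sub>R e') w) has_vector_derivative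
     (log_dir2 \<tau> e e' (s, z + t *\<^sub>R e') + log_dir \<tau> e (s, z + t *\<^sub>R e') w * log_dir \<tau> e' (s, z + t *\<^sub>R e') w)
      * kernel_at \<gamma> \<tau> (s, z + t *\<^sub>R e') w) (at t)"
proof -
  have d1: "((\<lambda>t. tau_coth \<tau> s / 2 * ((z + t *\<^sub>R e' - w) \<bullet> e)) has_real_derivative
      tau_coth \<tau> s / 2 * (e' \<bullet> e)) (at t)"
    unfolding inner_add_left inner_diff_left inner_scaleR_left by (auto intro!: derivative_eq_intros)
  have sy: "phase_form_deriv e (z + t *\<^sub>R e') w = phase_form_deriv e z w + t * (fst e \<bullet> snd e' + fst e' \<bullet> snd e)" for t
    by (simp add: phase_form_deriv_def inner_add_left inner_add_right inner_diff_left algebra_simps)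
  have d2: "((\<lambda>t. \<tau> / 2 * phase_form_deriv e (z + t *\<^sub>R e') w) has_real_derivative
      \<tau> / 2 * (fst e \<bullet> snd e' + fst e' \<bullet> snd e)) (at t)"
    unfolding sy by (auto intro!: derivative_eq_intros)
  have "((\<lambda>t. log_dir \<tau> e (s, z + t *\<^sub>R e') w) has_vector_derivative log_dir2 \<tau> e e' (s, z + t *\<^sub>R e')) (at t)"
    unfolding log_dir_def log_dir2_def fst_conv snd_conv
    by (intro has_vector_derivative_diff has_vector_derivative_minus has_vector_derivative_mult_right
        has_vector_derivative_of_real d1 d2)
  from has_vector_derivative_mult[OF this kernel_dir_deriv[of \<gamma> \<tau> s z e' w t]]
  show ?thesis
    by (rule has_vector_derivative_eq_rhs) (simp only: distrib_right mult.assoc add.commute)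
qed

lemma kernel_time_deriv:
  fixes z w :: "'n::finite phase_space"
  assumes "s > 0"
  shows "((\<lambda>s. kernel_at \<gamma> \<tau> (s, z) w) has_vector_derivative log_time \<gamma> \<tau> (s, z) w * kernel_at \<gamma> \<tau> (s, z) w) (at s)"
proof -
  let ?n = "CARD('n)" and ?r = "(norm (z - w))\<^sup>2"
  have "((\<lambda>s. - \<gamma> * of_real (s * \<tau> / 4) - of_real (tau_coth \<tau> s / 4 * ?r) - \<i> * of_real (\<tau> / 2 * phase_form z w))
      has_vector_derivative - \<gamma> * of_real (\<tau> / 4) - of_real (- ((tau_csch \<tau> s)\<^sup>2 / 4) / 4 * ?r) - 0) (at s)"
    by (intro has_vector_derivative_diff has_vector_derivative_const has_vector_derivative_mult_right
        has_vector_derivative_of_real) (auto intro!: derivative_eq_intros tau_coth_deriv[OF assms])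
  then have e: "((\<lambda>s. - \<gamma> * of_real (s * \<tau> / 4) - of_real (tau_coth \<tau> s / 4 * ?r) - \<i> * of_real (\<tau> / 2 * phase_form z w))
      has_vector_derivative of_real ((tau_csch \<tau> s)\<^sup>2 / 16 * ?r) - \<gamma> * of_real (\<tau> / 4)) (at s)"
    by (simp add: algebra_simps)
  have "((\<lambda>s. (tau_csch \<tau> s / (4 * pi)) ^ ?n) has_real_derivative
     of_nat ?n * (- (tau_csch \<tau> s * tau_coth \<tau> s / 4) / (4 * pi) * (tau_csch \<tau> s / (4 * pi)) ^ (?n - Suc 0))) (at s)"
    by (intro DERIV_power DERIV_cdivide tau_csch_deriv assms)
  moreover have "of_nat ?n * (- (tau_csch \<tau> s * tau_coth \<tau> s / 4) / (4 * pi) * (tau_csch \<tau> s / (4 * pi)) ^ (?n - Suc 0))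
     = - (?n * tau_coth \<tau> s / 4) * (tau_csch \<tau> s / (4 * pi)) ^ ?n"
    using power_Suc[of "tau_csch \<tau> s / (4 * pi)" "?n - Suc 0"] by simp
  ultimately have a: "((\<lambda>s. (tau_csch \<tau> s / (4 * pi)) ^ ?n) has_real_derivative
     - (?n * tau_coth \<tau> s / 4) * (tau_csch \<tau> s / (4 * pi)) ^ ?n) (at s)"
    by (rule DERIV_cong)
  note * = has_vector_derivative_mult[OF has_vector_derivative_of_real[OF a] has_vector_derivative_exp[OF e]]
  have eq: "of_real A * (b * E) + of_real (- (?n * c / 4) * A) * E
      = (of_real (S - ?n * c / 4) - \<gamma> * of_real (\<tau> / 4)) * (of_real A * E)"
      if "b = of_real S - \<gamma> * of_real (\<tau> / 4)" for A c S :: real and b E :: complex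
      unfolding that by (simp add: algebra_simps)
  show ?thesis
    unfolding kernel_at_alt log_time_def fst_conv snd_conv
    by (rule has_vector_derivative_eq_rhs[OF * eq[OF refl]])
qed

section \<open>Regularity and the heat equation\<close>

definition pos_time :: "(real \<times> 'a) set" where
  "pos_time = {0<..} \<times> UNIV"

lemma mem_pos_time [simp]: "(s, z) \<in> pos_time \<longleftrightarrow> s > 0"
  by (simp add: pos_time_def)

lemma continuous_on_kernel_at:
  "continuous_on (pos_time \<times> UNIV) (\<lambda>(p, w). kernel_at \<gamma> \<tau> p w)"
proof -
  have "continuous_on (pos_time \<times> UNIV) (\<lambda>x. kernel_at \<gamma> \<tau> (fst (fst x), snd (fst x)) (snd x))"
    unfolding kernel_at_alt phase_form_def
    by (intro continuous_intros) (auto simp: pos_time_def)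
  then show ?thesis by (simp add: split_def)
qed

text \<open>
On a compact set of parameters \<open>tau_coth\<close> has a positive minimum \<open>m\<close>, and
\<open>(norm (z - w))\<^sup>2 \<ge> (norm w)\<^sup>2 / 2 - (norm z)\<^sup>2\<close> turns decay in \<open>z - w\<close> into decay in \<open>w\<close>, the
term in \<open>z\<close> being absorbed into the continuous amplitude \<open>A\<close>.
\<close>

lemma gauss_dominated_kernel_at: "gauss_dominated pos_time (kernel_at \<gamma> \<tau>)"
  for \<gamma> :: complex and \<tau> :: real
  unfolding gauss_dominated_def
proof (intro conjI allI impI)
  fix C :: "(real \<times> 'n::finite phase_space) set" assume C: "compact C \<and> C \<subseteq> pos_time"
  show "\<exists>a>0. \<exists>B\<ge>0. \<forall>p\<in>C. \<forall>w. cmod (kernel_at \<gamma> \<tau> p w) \<le> B * exp (- a * (norm w)\<^sup>2)"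
  proof (cases "C = {}")
    case True
    then show ?thesis by (intro exI[of _ 1] conjI) auto
  next
    case False
    have "continuous_on C (\<lambda>p. tau_coth \<tau> (fst p))"
      using C by (intro continuous_intros) (auto simp: pos_time_def)
    then obtain p0 where p0: "p0 \<in> C" "\<And>p. p \<in> C \<Longrightarrow> tau_coth \<tau> (fst p0) \<le> tau_coth \<tau> (fst p)"
      using continuous_attains_inf[of C "\<lambda>p. tau_coth \<tau> (fst p)"] C False by blast
    define m where "m = tau_coth \<tau> (fst p0)"
    have m: "m > 0" unfolding m_def using C p0(1) by (intro tau_coth_pos) (auto simp: pos_time_def)
    define A where "A p = cmod (of_real ((tau_csch \<tau> (fst p) / (4 * pi)) ^ CARD('n)) * exp (- \<gamma> * of_real (fst p * \<tau> / 4)))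
      * exp (m / 4 * (norm (snd p))\<^sup>2)" for p :: "real \<times> 'n phase_space"
    have "continuous_on C A"
      unfolding A_def using C by (intro continuous_intros) (auto simp: pos_time_def)
    then obtain p1 where p1: "p1 \<in> C" "\<And>p. p \<in> C \<Longrightarrow> A p \<le> A p1"
      using continuous_attains_sup[of C A] C False by blast
    have bd: "cmod (kernel_at \<gamma> \<tau> p w) \<le> A p1 * exp (- (m / 8) * (norm w)\<^sup>2)" if p: "p \<in> C" for p w
    proof -
      obtain s z where sz: "p = (s, z)" by (cases p)
      have "norm w \<le> norm (z - w) + norm z"
        using norm_triangle_ineq4[of z "z - w"] by simp
      then have "(norm w)\<^sup>2 \<le> (norm (z - w) + norm z)\<^sup>2" by (intro power_mono) auto
      also have "\<dots> \<le> 2 * (norm (z - w))\<^sup>2 + 2 * (norm z)\<^sup>2"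
        using sum_squares_bound[of "norm (z - w)" "norm z"] by (simp add: power2_sum)
      finally have "(norm w)\<^sup>2 / 2 - (norm z)\<^sup>2 \<le> (norm (z - w))\<^sup>2" by simp
      then have "m / 4 * ((norm w)\<^sup>2 / 2 - (norm z)\<^sup>2) \<le> m / 4 * (norm (z - w))\<^sup>2"
        using m by (intro mult_left_mono) auto
      also have "\<dots> \<le> tau_coth \<tau> s / 4 * (norm (z - w))\<^sup>2"
        using p0(2)[OF p] by (intro mult_right_mono) (auto simp: sz m_def)
      finally have "- (tau_coth \<tau> s / 4 * (norm (z - w))\<^sup>2) \<le> m / 4 * (norm z)\<^sup>2 + - (m / 8) * (norm w)\<^sup>2"
        by (simp add: algebra_simps)
      then have e: "exp (- (tau_coth \<tau> s / 4 * (norm (z - w))\<^sup>2)) \<le> exp (m / 4 * (norm z)\<^sup>2) * exp (- (m / 8) * (norm w)\<^sup>2)"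
        unfolding exp_add[symmetric] by simp
      let ?K = "cmod (of_real ((tau_csch \<tau> s / (4 * pi)) ^ CARD('n)) * exp (- \<gamma> * of_real (s * \<tau> / 4)))"
      have "cmod (kernel_at \<gamma> \<tau> p w) = ?K * exp (- (tau_coth \<tau> s / 4 * (norm (z - w))\<^sup>2))"
        unfolding sz kernel_at_alt norm_mult norm_exp_eq_Re mult.assoc exp_add[symmetric] by simp
      also have "\<dots> \<le> ?K * (exp (m / 4 * (norm z)\<^sup>2) * exp (- (m / 8) * (norm w)\<^sup>2))"
        by (intro mult_left_mono e) auto
      also have "\<dots> = A p * exp (- (m / 8) * (norm w)\<^sup>2)"
        by (simp only: A_def sz fst_conv snd_conv mult.assoc)
      also have "\<dots> \<le> A p1 * exp (- (m / 8) * (norm w)\<^sup>2)"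
        using p1(2)[OF p] by (intro mult_right_mono) auto
      finally show ?thesis .
    qed
    have "A p1 \<ge> 0" by (simp add: A_def)
    then show ?thesis
      using m bd by (intro exI[of _ "m / 8"] conjI exI[of _ "A p1"] ballI allI) auto
  qed
qed (rule continuous_on_kernel_at)

definition log_dir_bound :: "real \<Rightarrow> 'n::finite phase_space \<Rightarrow> real \<times> 'n phase_space \<Rightarrow> real" where
  "log_dir_bound \<tau> e p = (tau_coth \<tau> (fst p) / 2 + \<bar>\<tau>\<bar>) * norm e * (1 + norm (snd p))"

lemma log_dir_bound_nonneg: "fst p > 0 \<Longrightarrow> log_dir_bound \<tau> e p \<ge> 0"
  using tau_coth_pos[of "fst p" \<tau>] by (simp add: log_dir_bound_def)

lemma norm_fst_snd_le: "norm (fst z) \<le> norm z" "norm (snd z) \<le> norm z"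
  by (simp_all add: norm_prod_def real_le_rsqrt)

lemma norm_log_dir_le:
  fixes w e :: "'n::finite phase_space"
  assumes "fst p > 0"
  shows "cmod (log_dir \<tau> e p w) \<le> log_dir_bound \<tau> e p * (1 + norm w)"
proof -
  obtain s z where p: "p = (s, z)" by (cases p)
  have c: "tau_coth \<tau> s > 0" using assms p tau_coth_pos by simp
  have prod: "norm z + norm w \<le> (1 + norm z) * (1 + norm w)"
    by (simp add: algebra_simps)
  have "\<bar>(z - w) \<bullet> e\<bar> \<le> norm (z - w) * norm e" by (rule Cauchy_Schwarz_ineq2)
  also have "\<dots> \<le> (norm z + norm w) * norm e" by (intro mult_right_mono norm_triangle_ineq4) auto
  also have "\<dots> \<le> ((1 + norm z) * (1 + norm w)) * norm e" by (intro mult_right_mono prod) auto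
  finally have 1: "\<bar>(z - w) \<bullet> e\<bar> \<le> (1 + norm z) * (1 + norm w) * norm e" .
  have "\<bar>fst e \<bullet> (snd z + snd w)\<bar> \<le> norm (fst e) * norm (snd z + snd w)" by (rule Cauchy_Schwarz_ineq2)
  also have "\<dots> \<le> norm e * (norm z + norm w)"
    by (intro mult_mono order_trans[OF norm_triangle_ineq] add_mono norm_fst_snd_le) auto
  finally have 2: "\<bar>fst e \<bullet> (snd z + snd w)\<bar> \<le> norm e * (norm z + norm w)" .
  have "\<bar>(fst z - fst w) \<bullet> snd e\<bar> \<le> norm (fst z - fst w) * norm (snd e)" by (rule Cauchy_Schwarz_ineq2)
  also have "\<dots> \<le> (norm z + norm w) * norm e"
    by (intro mult_mono order_trans[OF norm_triangle_ineq4] add_mono norm_fst_snd_le) auto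
  finally have "\<bar>phase_form_deriv e z w\<bar> \<le> 2 * (norm e * (norm z + norm w))"
    unfolding phase_form_deriv_def using 2 by (simp add: mult.commute)
  also have "\<dots> \<le> 2 * (norm e * ((1 + norm z) * (1 + norm w)))"
    by (intro mult_left_mono prod) auto
  finally have 3: "\<bar>phase_form_deriv e z w\<bar> \<le> 2 * (norm e * ((1 + norm z) * (1 + norm w)))" .
  have "cmod (log_dir \<tau> e p w) \<le> cmod (of_real (tau_coth \<tau> s / 2 * ((z - w) \<bullet> e))) + cmod (\<i> * of_real (\<tau> / 2 * phase_form_deriv e z w))"
    unfolding log_dir_def p fst_conv snd_conv by (intro order_trans[OF norm_triangle_ineq4]) (simp only: norm_minus_cancel order_refl)
  also have "\<dots> = tau_coth \<tau> s / 2 * \<bar>(z - w) \<bullet> e\<bar> + \<bar>\<tau>\<bar> / 2 * \<bar>phase_form_deriv e z w\<bar>"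
    using c unfolding norm_mult norm_of_real norm_ii by (simp add: abs_mult)
  also have "\<dots> \<le> tau_coth \<tau> s / 2 * ((1 + norm z) * (1 + norm w) * norm e) + \<bar>\<tau>\<bar> / 2 * (2 * (norm e * ((1 + norm z) * (1 + norm w))))"
    using c by (intro add_mono mult_left_mono 1 3) auto
  also have "\<dots> = log_dir_bound \<tau> e p * (1 + norm w)"
    by (simp add: log_dir_bound_def p algebra_simps)
  finally show ?thesis .
qed

lemma one_plus_norm_sq: "(1 + norm w)\<^sup>2 \<le> 2 * (1 + (norm w)\<^sup>2)" for w :: "'a::real_normed_vector"
  using sum_squares_bound[of 1 "norm w"] by (simp add: power2_sum)

lemma one_plus_norm_le: "1 + norm w \<le> 2 * (1 + (norm w)\<^sup>2)" for w :: "'a::real_normed_vector"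
proof -
  have "(0::real) \<le> (2 * norm w - 1)\<^sup>2" by simp
  also have "\<dots> \<le> 4 * (2 * (1 + (norm w)\<^sup>2) - (1 + norm w))"
    by (simp add: power2_diff algebra_simps)
  finally show ?thesis by simp
qed

lemma continuous_on_log_dir:
  fixes e :: "'n::finite phase_space"
  shows
  "continuous_on (pos_time \<times> UNIV) (\<lambda>(p, w). log_dir \<tau> e p w)"
  unfolding log_dir_def phase_form_deriv_def split_def
  by (intro continuous_intros) (auto simp: pos_time_def)

lemma gauss_dominated_log_dir:
  fixes e :: "'n::finite phase_space"
  shows
  "gauss_dominated pos_time (\<lambda>p w. log_dir \<tau> e p w * kernel_at \<gamma> \<tau> p w)"
proof (rule gauss_dominated_mult[OF gauss_dominated_kernel_at continuous_on_log_dir])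
  show "continuous_on pos_time (\<lambda>p. 2 * log_dir_bound \<tau> e p)"
    unfolding log_dir_bound_def by (intro continuous_intros) (auto simp: pos_time_def)
  fix p :: "real \<times> 'n phase_space" and w :: "'n phase_space" assume "p \<in> pos_time"
  then have p: "fst p > 0" by (auto simp: pos_time_def)
  have "cmod (log_dir \<tau> e p w) \<le> log_dir_bound \<tau> e p * (1 + norm w)" by (rule norm_log_dir_le[OF p])
  also have "\<dots> \<le> log_dir_bound \<tau> e p * (2 * (1 + (norm w)\<^sup>2))"
    by (intro mult_left_mono one_plus_norm_le log_dir_bound_nonneg p)
  finally show "cmod (log_dir \<tau> e p w) \<le> 2 * log_dir_bound \<tau> e p * (1 + (norm w)\<^sup>2)" by (simp only: mult_ac)
qed

lemma gauss_dominated_log_dir2: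
  fixes e e' :: "'n::finite phase_space"
  shows
  "gauss_dominated pos_time (\<lambda>p w. (log_dir2 \<tau> e e' p + log_dir \<tau> e p w * log_dir \<tau> e' p w) * kernel_at \<gamma> \<tau> p w)"
proof (rule gauss_dominated_mult[OF gauss_dominated_kernel_at])
  let ?b = "\<lambda>p. cmod (log_dir2 \<tau> e e' p) + 2 * (log_dir_bound \<tau> e p * log_dir_bound \<tau> e' p)"
  have c2: "continuous_on pos_time (log_dir2 \<tau> e e')"
    unfolding log_dir2_def by (intro continuous_intros) (auto simp: pos_time_def)
  show "continuous_on pos_time ?b"
    unfolding log_dir_bound_def by (intro continuous_intros c2) (auto simp: pos_time_def)
  have "continuous_on (pos_time \<times> UNIV) (\<lambda>x. log_dir2 \<tau> e e' (fst x))"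
    by (rule continuous_on_compose2[OF c2]) (auto intro: continuous_intros)
  then show "continuous_on (pos_time \<times> UNIV) (\<lambda>(p, w). log_dir2 \<tau> e e' p + log_dir \<tau> e p w * log_dir \<tau> e' p w)"
    using continuous_on_log_dir[of \<tau> e] continuous_on_log_dir[of \<tau> e'] unfolding split_def
    by (intro continuous_on_add continuous_on_mult)
  fix p :: "real \<times> 'n phase_space" and w :: "'n phase_space" assume "p \<in> pos_time"
  then have p: "fst p > 0" by (auto simp: pos_time_def)
  have "cmod (log_dir \<tau> e p w * log_dir \<tau> e' p w) \<le> (log_dir_bound \<tau> e p * (1 + norm w)) * (log_dir_bound \<tau> e' p * (1 + norm w))"
    unfolding norm_mult by (intro mult_mono norm_log_dir_le p mult_nonneg_nonneg log_dir_bound_nonneg) auto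
  also have "\<dots> = (log_dir_bound \<tau> e p * log_dir_bound \<tau> e' p) * (1 + norm w)\<^sup>2"
    by (simp add: power2_eq_square mult_ac)
  also have "\<dots> \<le> (log_dir_bound \<tau> e p * log_dir_bound \<tau> e' p) * (2 * (1 + (norm w)\<^sup>2))"
    by (intro mult_left_mono one_plus_norm_sq mult_nonneg_nonneg log_dir_bound_nonneg p)
  finally have 1: "cmod (log_dir \<tau> e p w * log_dir \<tau> e' p w) \<le> 2 * (log_dir_bound \<tau> e p * log_dir_bound \<tau> e' p) * (1 + (norm w)\<^sup>2)"
    by (simp only: mult_ac)
  have "cmod (log_dir2 \<tau> e e' p) * 1 \<le> cmod (log_dir2 \<tau> e e' p) * (1 + (norm w)\<^sup>2)"
    by (intro mult_left_mono) auto
  with 1 show "cmod (log_dir2 \<tau> e e' p + log_dir \<tau> e p w * log_dir \<tau> e' p w) \<le> ?b p * (1 + (norm w)\<^sup>2)"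
    using norm_triangle_ineq[of "log_dir2 \<tau> e e' p" "log_dir \<tau> e p w * log_dir \<tau> e' p w"]
    unfolding distrib_right mult_1_right by linarith
qed

lemma gauss_dominated_log_time:
  "gauss_dominated pos_time (\<lambda>p (w::'n::finite phase_space). log_time \<gamma> \<tau> p w * kernel_at \<gamma> \<tau> p w)"
proof (rule gauss_dominated_mult[OF gauss_dominated_kernel_at])
  let ?b = "\<lambda>p::real \<times> 'n phase_space. (tau_csch \<tau> (fst p))\<^sup>2 / 8 * (1 + (norm (snd p))\<^sup>2) + CARD('n) * tau_coth \<tau> (fst p) / 4 + cmod (\<gamma> * of_real (\<tau> / 4))"
  show "continuous_on pos_time ?b"
    by (intro continuous_intros) (auto simp: pos_time_def)
  show "continuous_on (pos_time \<times> UNIV) (\<lambda>(p, w::'n phase_space). log_time \<gamma> \<tau> p w)"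
    unfolding log_time_def split_def by (intro continuous_intros) (auto simp: pos_time_def)
  fix p :: "real \<times> 'n phase_space" and w :: "'n phase_space" assume "p \<in> pos_time"
  then have p: "fst p > 0" by (auto simp: pos_time_def)
  let ?S = "(tau_csch \<tau> (fst p))\<^sup>2" and ?c = "CARD('n) * tau_coth \<tau> (fst p) / 4"
  have c: "?c \<ge> 0" using tau_coth_pos[OF p, of \<tau>] by simp
  have "(norm (snd p - w))\<^sup>2 \<le> (norm (snd p) + norm w)\<^sup>2"
    by (intro power_mono norm_triangle_ineq4) auto
  also have "\<dots> \<le> 2 * (norm (snd p))\<^sup>2 + 2 * (norm w)\<^sup>2"
    using sum_squares_bound[of "norm (snd p)" "norm w"] by (simp add: power2_sum)
  also have "\<dots> \<le> 2 * ((1 + (norm (snd p))\<^sup>2) * (1 + (norm w)\<^sup>2))"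
    by (simp add: algebra_simps)
  finally have "?S / 16 * (norm (snd p - w))\<^sup>2 \<le> ?S / 16 * (2 * ((1 + (norm (snd p))\<^sup>2) * (1 + (norm w)\<^sup>2)))"
    by (intro mult_left_mono) auto
  then have 1: "?S / 16 * (norm (snd p - w))\<^sup>2 \<le> ?S / 8 * (1 + (norm (snd p))\<^sup>2) * (1 + (norm w)\<^sup>2)"
    by (simp add: mult_ac)
  have 2: "?c * 1 \<le> ?c * (1 + (norm w)\<^sup>2)" "cmod (\<gamma> * of_real (\<tau> / 4)) * 1 \<le> cmod (\<gamma> * of_real (\<tau> / 4)) * (1 + (norm w)\<^sup>2)"
    using c by (intro mult_left_mono; simp)+
  have "0 \<le> ?S / 16 * (norm (snd p - w))\<^sup>2" by simp
  then have "cmod (of_real (?S / 16 * (norm (snd p - w))\<^sup>2 - ?c)) \<le> ?S / 16 * (norm (snd p - w))\<^sup>2 + ?c"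
    unfolding norm_of_real using c by linarith
  then have "cmod (log_time \<gamma> \<tau> p w) \<le> ?S / 16 * (norm (snd p - w))\<^sup>2 + ?c + cmod (\<gamma> * of_real (\<tau> / 4))"
    unfolding log_time_def using norm_triangle_ineq4[of "of_real (?S / 16 * (norm (snd p - w))\<^sup>2 - ?c)" "\<gamma> * of_real (\<tau> / 4)"]
    by linarith
  then show "cmod (log_time \<gamma> \<tau> p w) \<le> ?b p * (1 + (norm w)\<^sup>2)"
    using 1 2 unfolding distrib_right mult_1_right by linarith
qed

context
  fixes \<gamma> :: complex and \<tau> :: real and f :: "'n::finite phase_space \<Rightarrow> complex"
  assumes f: "square_integrable f"
begin

lemma heat_integral_dir_deriv:
  assumes s: "s > 0"
  shows "((\<lambda>t. heat_integral \<gamma> \<tau> f s (z + t *\<^sub>R e)) has_vector_derivative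
     (LINT w|lebesgue. log_dir \<tau> e (s, z) w * kernel_at \<gamma> \<tau> (s, z) w * f w)) (at 0)"
proof -
  have "((\<lambda>t. LINT w|lebesgue. kernel_at \<gamma> \<tau> (s, z + t *\<^sub>R e) w * f w) has_vector_derivative
     (LINT w|lebesgue. log_dir \<tau> e (s, z + 0 *\<^sub>R e) w * kernel_at \<gamma> \<tau> (s, z + 0 *\<^sub>R e) w * f w)) (at 0)"
    using s by (intro gauss_dominated_has_vector_derivative[OF gauss_dominated_kernel_at gauss_dominated_log_dir f, where d=1]
       kernel_dir_deriv continuous_intros) (auto simp: pos_time_def)
  then show ?thesis by (simp add: heat_integral_eq)
qed

lemma heat_integral_dir_deriv_eq:
  assumes s: "s > 0"
  shows "dir_deriv e (heat_integral \<gamma> \<tau> f s) = (\<lambda>z. LINT w|lebesgue. log_dir \<tau> e (s, z) w * kernel_at \<gamma> \<tau> (s, z) w * f w)"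
  unfolding dir_deriv_def by (intro ext vector_derivative_at heat_integral_dir_deriv s)

lemma heat_integral_dir_deriv2:
  assumes s: "s > 0"
  shows "((\<lambda>t. dir_deriv e (heat_integral \<gamma> \<tau> f s) (z + t *\<^sub>R e')) has_vector_derivative
     (LINT w|lebesgue. (log_dir2 \<tau> e e' (s, z) + log_dir \<tau> e (s, z) w * log_dir \<tau> e' (s, z) w) * kernel_at \<gamma> \<tau> (s, z) w * f w)) (at 0)"
proof -
  have "((\<lambda>t. LINT w|lebesgue. log_dir \<tau> e (s, z + t *\<^sub>R e') w * kernel_at \<gamma> \<tau> (s, z + t *\<^sub>R e') w * f w) has_vector_derivative
     (LINT w|lebesgue. (log_dir2 \<tau> e e' (s, z + 0 *\<^sub>R e') + log_dir \<tau> e (s, z + 0 *\<^sub>R e') w * log_dir \<tau> e' (s, z + 0 *\<^sub>R e') w)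
        * kernel_at \<gamma> \<tau> (s, z + 0 *\<^sub>R e') w * f w)) (at 0)"
    using s by (intro gauss_dominated_has_vector_derivative[OF gauss_dominated_log_dir gauss_dominated_log_dir2 f, where d=1]
       kernel_dir_deriv2 continuous_intros) (auto simp: pos_time_def)
  then show ?thesis by (simp add: heat_integral_dir_deriv_eq[OF s])
qed

lemma heat_integral_dir_deriv2_eq:
  assumes s: "s > 0"
  shows "dir_deriv e' (dir_deriv e (heat_integral \<gamma> \<tau> f s)) z =
    (LINT w|lebesgue. (log_dir2 \<tau> e e' (s, z) + log_dir \<tau> e (s, z) w * log_dir \<tau> e' (s, z) w) * kernel_at \<gamma> \<tau> (s, z) w * f w)"
  unfolding dir_deriv_def[of e'] by (intro vector_derivative_at heat_integral_dir_deriv2 s)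

lemma heat_integral_time_deriv:
  assumes s: "s > 0"
  shows "((\<lambda>\<sigma>. heat_integral \<gamma> \<tau> f \<sigma> z) has_vector_derivative
     (LINT w|lebesgue. log_time \<gamma> \<tau> (s, z) w * kernel_at \<gamma> \<tau> (s, z) w * f w)) (at s)"
  unfolding heat_integral_eq
proof (rule gauss_dominated_has_vector_derivative[OF gauss_dominated_kernel_at gauss_dominated_log_time f, where d="s/2"])
  have pos: "t > 0" if "t \<in> cball s (s/2)" for t
    using that s unfolding mem_cball dist_real_def by linarith
  show "continuous_on (cball s (s/2)) (\<lambda>\<sigma>. (\<sigma>, z))" by (intro continuous_intros)
  show "(\<lambda>\<sigma>. (\<sigma>, z)) ` cball s (s/2) \<subseteq> pos_time" using pos by (auto simp: pos_time_def)
  show "((\<lambda>t. kernel_at \<gamma> \<tau> (t, z) w) has_vector_derivative log_time \<gamma> \<tau> (t, z) w * kernel_at \<gamma> \<tau> (t, z) w) (at t)"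
    if "t \<in> cball s (s/2)" for t w
    by (rule kernel_time_deriv[OF pos[OF that]])
qed (use s in simp)

lemma C12_pos_heat_integral: "C12_pos (heat_integral \<gamma> \<tau> f)"
proof -
  have c: "continuous_on ({0<..} \<times> UNIV) (\<lambda>p. LINT w|lebesgue. k p w * f w)" if "gauss_dominated pos_time k" for k
    using gauss_dominated_continuous_integral[OF that f] by (simp add: pos_time_def)
  show ?thesis
    unfolding C12_pos_def
  proof (intro conjI ballI allI impI)
    fix s :: real and z assume s: "s > 0"
    show "(\<lambda>\<sigma>. heat_integral \<gamma> \<tau> f \<sigma> z) differentiable (at s)"
      using heat_integral_time_deriv[OF s] by (rule differentiableI_vector)
    show "has_dir_deriv e (heat_integral \<gamma> \<tau> f s) z" for e
      unfolding has_dir_deriv_def using heat_integral_dir_deriv[OF s] by (rule differentiableI_vector)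
    show "has_dir_deriv e' (dir_deriv e (heat_integral \<gamma> \<tau> f s)) z" for e e'
      unfolding has_dir_deriv_def using heat_integral_dir_deriv2[OF s] by (rule differentiableI_vector)
  next
    show "continuous_on ({0<..} \<times> UNIV) (\<lambda>(s, z). vector_derivative (\<lambda>\<sigma>. heat_integral \<gamma> \<tau> f \<sigma> z) (at s))"
      using c[OF gauss_dominated_log_time, of \<gamma> \<tau>]
      by (rule continuous_on_eq) (auto simp: vector_derivative_at[OF heat_integral_time_deriv])
  next
    fix e :: "'n phase_space"
    show "continuous_on ({0<..} \<times> UNIV) (\<lambda>(s, z). dir_deriv e (heat_integral \<gamma> \<tau> f s) z)"
      using c[OF gauss_dominated_log_dir, of \<tau> e \<gamma>]
      by (rule continuous_on_eq) (auto simp: heat_integral_dir_deriv_eq)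
    fix e' :: "'n phase_space"
    show "continuous_on ({0<..} \<times> UNIV) (\<lambda>(s, z). dir_deriv e' (dir_deriv e (heat_integral \<gamma> \<tau> f s)) z)"
      using c[OF gauss_dominated_log_dir2, of \<tau> e e' \<gamma>]
      by (rule continuous_on_eq) (auto simp: heat_integral_dir_deriv2_eq)
  qed
qed

end

text \<open>
The kernel solves the heat equation: this is the equation divided by the kernel. All terms of second
and first order and the potential split into contributions of the single coordinates, and for each
coordinate they add up to \<open>S / 4 * ((x $ j - x' $ j)\<^sup>2 + (y $ j - y' $ j)\<^sup>2) - c\<close>, where
\<open>S = (tau_csch \<tau> s)\<^sup>2\<close> enters as \<open>c\<^sup>2 - \<tau>\<^sup>2\<close>. The sum over the coordinates is four times
the logarithmic time derivative, up to the term in \<open>\<gamma>\<close>.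
\<close>

lemma log_identity:
  fixes x y :: "real^'n"
  assumes s: "s > 0"
  shows "log_time \<gamma> \<tau> (s, (x, y)) w + - (1 / 4) *
     ((\<Sum>j\<in>UNIV. (log_dir2 \<tau> (axis j 1, 0) (axis j 1, 0) (s, (x, y)) + log_dir \<tau> (axis j 1, 0) (s, (x, y)) w * log_dir \<tau> (axis j 1, 0) (s, (x, y)) w)
         + (log_dir2 \<tau> (0, axis j 1) (0, axis j 1) (s, (x, y)) + log_dir \<tau> (0, axis j 1) (s, (x, y)) w * log_dir \<tau> (0, axis j 1) (s, (x, y)) w))
      + 2 * \<i> * of_real \<tau> * (\<Sum>j\<in>UNIV. of_real (y $ j) * log_dir \<tau> (axis j 1, 0) (s, (x, y)) w)
      - (of_real (\<tau>\<^sup>2 * (y \<bullet> y)) + \<gamma> * of_real \<tau>)) = 0"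
proof -
  obtain x' y' where w: "w = (x', y')" by (cases w)
  define c where "c = tau_coth \<tau> s"
  define S where "S = (tau_csch \<tau> s)\<^sup>2"
  have S: "S = c\<^sup>2 - \<tau>\<^sup>2" unfolding S_def c_def by (simp add: tau_coth_sq_minus[OF s])
  let ?T = "\<lambda>j. (log_dir2 \<tau> (axis j 1, 0) (axis j 1, 0) (s, (x, y)) + log_dir \<tau> (axis j 1, 0) (s, (x, y)) w * log_dir \<tau> (axis j 1, 0) (s, (x, y)) w)
         + (log_dir2 \<tau> (0, axis j 1) (0, axis j 1) (s, (x, y)) + log_dir \<tau> (0, axis j 1) (s, (x, y)) w * log_dir \<tau> (0, axis j 1) (s, (x, y)) w)"
  let ?U = "\<lambda>j. of_real (y $ j) * log_dir \<tau> (axis j 1, 0) (s, (x, y)) w"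
  have tm: "?T j + 2 * \<i> * of_real \<tau> * ?U j - of_real (\<tau>\<^sup>2 * (y $ j)\<^sup>2)
     = of_real (S / 4 * ((x $ j - x' $ j)\<^sup>2 + (y $ j - y' $ j)\<^sup>2) - c)" for j
  proof -
    have alg: "(- (C / 2) + (- (C / 2 * a) - \<i> * (T / 2 * (Y + Y'))) * (- (C / 2 * a) - \<i> * (T / 2 * (Y + Y'))))
      + (- (C / 2) + (- (C / 2 * (Y - Y')) - \<i> * (T / 2 * a)) * (- (C / 2 * (Y - Y')) - \<i> * (T / 2 * a)))
      + 2 * \<i> * T * (Y * (- (C / 2 * a) - \<i> * (T / 2 * (Y + Y')))) - T\<^sup>2 * Y\<^sup>2
      = (C\<^sup>2 - T\<^sup>2) / 4 * (a\<^sup>2 + (Y - Y')\<^sup>2) - C" for C T a Y Y' :: complex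
      by (simp add: field_simps power2_eq_square) 
    show ?thesis
      using alg[of "of_real c" "of_real (x $ j - x' $ j)" "of_real \<tau>" "of_real (y $ j)" "of_real (y' $ j)"]
      by (simp add: log_dir_def log_dir2_def phase_form_deriv_def w c_def[symmetric] S inner_axis inner_axis' cart_eq_inner_axis[symmetric])
  qed
  have yy: "of_real (\<tau>\<^sup>2 * (y \<bullet> y)) = (\<Sum>j\<in>UNIV. complex_of_real (\<tau>\<^sup>2 * (y $ j)\<^sup>2))"
    by (simp add: inner_vec_def sum_distrib_left power2_eq_square)
  have nn: "(norm ((x, y) - w))\<^sup>2 = (\<Sum>j\<in>UNIV. (x $ j - x' $ j)\<^sup>2 + (y $ j - y' $ j)\<^sup>2)"
    unfolding w by (simp add: power2_norm_eq_inner inner_vec_def sum.distrib flip: power2_eq_square)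
  have "(\<Sum>j\<in>UNIV. ?T j) + 2 * \<i> * of_real \<tau> * (\<Sum>j\<in>UNIV. ?U j) - of_real (\<tau>\<^sup>2 * (y \<bullet> y))
    = (\<Sum>j\<in>UNIV. ?T j + 2 * \<i> * of_real \<tau> * ?U j - of_real (\<tau>\<^sup>2 * (y $ j)\<^sup>2))"
    unfolding yy by (simp only: sum.distrib sum_subtractf sum_distrib_left)
  also have "\<dots> = of_real (S / 4 * (norm ((x, y) - w))\<^sup>2 - CARD('n) * c)"
    unfolding tm nn by (simp add: sum_subtractf sum_distrib_left)
  finally have sum: "(\<Sum>j\<in>UNIV. ?T j) + 2 * \<i> * of_real \<tau> * (\<Sum>j\<in>UNIV. ?U j) - of_real (\<tau>\<^sup>2 * (y \<bullet> y))
     = of_real (S / 4 * (norm ((x, y) - w))\<^sup>2 - CARD('n) * c)" .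
  have fin: "L + - (1 / 4) * (A + B - (D + G)) = L - 1/4 * (A + B - D) + G / 4" for L A B D G :: complex
    by (simp add: field_simps)
  show ?thesis
    unfolding fin sum by (simp add: log_time_def S_def[symmetric] c_def[symmetric] field_simps)
qed

lemma heat_integral_solves:
  fixes f :: "(real^'n) \<times> (real^'n) \<Rightarrow> complex"
  assumes f: "square_integrable f" and s: "s > 0"
  shows "vector_derivative (\<lambda>\<sigma>. heat_integral \<gamma> \<tau> f \<sigma> (x, y)) (at s)
            + L_tilde \<gamma> \<tau> (heat_integral \<gamma> \<tau> f s) (x, y) = 0"
proof -
  let ?p = "(s, (x, y))"
  let ?h = "\<lambda>w. kernel_at \<gamma> \<tau> ?p w * f w"
  let ?T = "\<lambda>e w. log_dir2 \<tau> e e ?p + log_dir \<tau> e ?p w * log_dir \<tau> e ?p w"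
  have p: "?p \<in> pos_time" using s by simp
  note int = gauss_dominated_integrable[OF _ p f]
  have i0: "integrable lebesgue ?h" by (rule int[OF gauss_dominated_kernel_at])
  have i1: "integrable lebesgue (\<lambda>w. log_dir \<tau> e ?p w * ?h w)" for e
    using int[OF gauss_dominated_log_dir, of \<tau> e \<gamma>] by (simp only: mult.assoc)
  have i2: "integrable lebesgue (\<lambda>w. ?T e w * ?h w)" for e
    using int[OF gauss_dominated_log_dir2, of \<tau> e e \<gamma>] by (simp only: mult.assoc)
  have i3: "integrable lebesgue (\<lambda>w. log_time \<gamma> \<tau> ?p w * ?h w)"
    using int[OF gauss_dominated_log_time, of \<gamma> \<tau>] by (simp only: mult.assoc)
  have "vector_derivative (\<lambda>\<sigma>. heat_integral \<gamma> \<tau> f \<sigma> (x, y)) (at s) + L_tilde \<gamma> \<tau> (heat_integral \<gamma> \<tau> f s) (x, y)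
    = (LINT w|lebesgue. log_time \<gamma> \<tau> ?p w * ?h w) + - (1 / 4) *
     ((\<Sum>j\<in>UNIV. (LINT w|lebesgue. ?T (axis j 1, 0) w * ?h w) + (LINT w|lebesgue. ?T (0, axis j 1) w * ?h w))
      + 2 * \<i> * of_real \<tau> * (\<Sum>j\<in>UNIV. of_real (y $ j) * (LINT w|lebesgue. log_dir \<tau> (axis j 1, 0) ?p w * ?h w))
      - (of_real (\<tau>\<^sup>2 * (y \<bullet> y)) + \<gamma> * of_real \<tau>) * (LINT w|lebesgue. ?h w))"
    unfolding L_tilde_def split vector_derivative_at[OF heat_integral_time_deriv[OF f s]]
      heat_integral_dir_deriv2_eq[OF f s]
    unfolding heat_integral_dir_deriv_eq[OF f s]
    unfolding heat_integral_eq mult.assoc ..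
  also have "\<dots> = (LINT w|lebesgue. log_time \<gamma> \<tau> ?p w * ?h w + - (1 / 4) *
     ((\<Sum>j\<in>UNIV. ?T (axis j 1, 0) w * ?h w + ?T (0, axis j 1) w * ?h w)
      + 2 * \<i> * of_real \<tau> * (\<Sum>j\<in>UNIV. of_real (y $ j) * (log_dir \<tau> (axis j 1, 0) ?p w * ?h w))
      - (of_real (\<tau>\<^sup>2 * (y \<bullet> y)) + \<gamma> * of_real \<tau>) * ?h w))"
    by (simp only: Bochner_Integration.integral_add Bochner_Integration.integral_diff Bochner_Integration.integral_sum 
       integral_mult_right_zero Bochner_Integration.integrable_add Bochner_Integration.integrable_diff Bochner_Integration.integrable_sum 
       integrable_mult_right i0 i1 i2 i3)
  also have "\<dots> = (LINT w|lebesgue. (log_time \<gamma> \<tau> ?p w + - (1 / 4) *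
     ((\<Sum>j\<in>UNIV. ?T (axis j 1, 0) w + ?T (0, axis j 1) w)
      + 2 * \<i> * of_real \<tau> * (\<Sum>j\<in>UNIV. of_real (y $ j) * log_dir \<tau> (axis j 1, 0) ?p w)
      - (of_real (\<tau>\<^sup>2 * (y \<bullet> y)) + \<gamma> * of_real \<tau>))) * ?h w)"
    by (intro arg_cong[where f="integral\<^sup>L lebesgue"] ext)
      (simp only: distrib_right left_diff_distrib mult.assoc sum_distrib_right)
  also have "\<dots> = (LINT w|lebesgue. 0 * ?h w)"
    unfolding log_identity[OF s] ..
  finally show ?thesis by simp
qed

section \<open>The initial condition\<close>

lemma filterlim_tau_coth: "filterlim (\<lambda>s. tau_coth \<tau> s) at_top (at_right 0)"
proof -
  have pos: "filterlim (\<lambda>s. tau_coth \<tau> s) at_top (at_right 0)" if "\<tau> \<ge> 0" for \<tau>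
  proof (cases "\<tau> = 0")
    case True
    then show ?thesis unfolding tau_coth_def by simp real_asymp
  next
    case False
    then have "\<tau> > 0" using that by simp
    then show ?thesis unfolding tau_coth_def by simp real_asymp
  qed
  have "tau_coth (- \<tau>) = tau_coth \<tau>" by (simp add: tau_coth_def fun_eq_iff)
  then show ?thesis using pos[of \<tau>] pos[of "- \<tau>"] by (cases "\<tau> \<ge> 0") auto
qed

text \<open>
The integral of the kernel over \<open>w\<close> once its oscillating factor has been removed; the power of \<open>cosh\<close> is the quotient of \<open>tau_coth\<close>, which normalises the Gaussian, by \<open>tau_csch\<close>.
\<close>

definition heat_mass :: "nat \<Rightarrow> complex \<Rightarrow> real \<Rightarrow> real \<Rightarrow> complex" where
  "heat_mass n \<gamma> \<tau> s = exp (- \<gamma> * of_real (s * \<tau> / 4)) / of_real (cosh (s * \<tau> / 4) ^ n)"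

lemma tendsto_heat_mass: "(heat_mass n \<gamma> \<tau> \<longlongrightarrow> 1) (at_right 0)"
proof -
  have "((\<lambda>s. exp (- \<gamma> * of_real (s * \<tau> / 4)) / of_real (cosh (s * \<tau> / 4) ^ n))
     \<longlongrightarrow> exp (- \<gamma> * of_real (0 * \<tau> / 4)) / of_real (cosh (0 * \<tau> / 4) ^ n)) (at_right 0)"
    by (intro tendsto_intros) auto
  then show ?thesis by (simp add: heat_mass_def[abs_def])
qed

definition heat_phase :: "real \<Rightarrow> 'n::finite phase_space \<Rightarrow> 'n phase_space \<Rightarrow> real" where
  "heat_phase \<tau> w z = \<tau> / 2 * (fst w \<bullet> (2 *\<^sub>R snd z + snd w))"

lemma continuous_on_heat_phase: "continuous_on UNIV (\<lambda>(w, z). heat_phase \<tau> w z)"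
  unfolding heat_phase_def split_def by (intro continuous_intros)

text \<open>
Centring the integration variable at \<open>z\<close> exhibits the kernel as a scalar times a Gaussian
probability density times a unimodular factor that is trivial for \<open>w = 0\<close>.
\<close>

lemma kernel_at_translate:
  fixes z w :: "'n::finite phase_space"
  assumes s: "s > 0"
  shows "kernel_at \<gamma> \<tau> (s, z) (z + w) = heat_mass CARD('n) \<gamma> \<tau> s
     * (of_real (gauss_density (tau_coth \<tau> s / 4) w) * cis (heat_phase \<tau> w z))"
proof -
  let ?n = "CARD('n)" and ?c = "tau_coth \<tau> s" and ?C = "cosh (s * \<tau> / 4)"
  have c: "?c > 0" by (rule tau_coth_pos[OF s])
  have "sqrt (pi / (?c / 4)) ^ DIM('n phase_space) = (sqrt (pi / (?c / 4)) ^ 2) ^ ?n"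
    by (simp add: mult_2 flip: power_mult)
  also have "\<dots> = (4 * pi / ?c) ^ ?n"
    using c by (simp add: mult.commute)
  finally have g: "gauss_density (?c / 4) w = (?c / (4 * pi)) ^ ?n * exp (- (?c / 4 * (norm w)\<^sup>2))"
    unfolding gauss_density_def by (simp add: power_divide)
  have "(tau_csch \<tau> s / (4 * pi)) ^ ?n = (?c / (4 * pi)) ^ ?n / ?C ^ ?n"
    by (simp add: tau_coth_eq power_divide power_mult_distrib)
  then have m: "complex_of_real ((tau_csch \<tau> s / (4 * pi)) ^ ?n) * exp (- \<gamma> * of_real (s * \<tau> / 4))
     = heat_mass ?n \<gamma> \<tau> s * of_real ((?c / (4 * pi)) ^ ?n)"
    by (simp add: heat_mass_def)
  have sy: "- \<i> * of_real (\<tau> / 2 * phase_form z (z + w)) = \<i> * of_real (heat_phase \<tau> w z)"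
    by (simp add: phase_form_def heat_phase_def scaleR_2 add.assoc)
  have "exp (- \<gamma> * of_real (s * \<tau> / 4) - of_real (?c / 4 * (norm (z - (z + w)))\<^sup>2) - \<i> * of_real (\<tau> / 2 * phase_form z (z + w)))
     = exp (- \<gamma> * of_real (s * \<tau> / 4) + (of_real (- (?c / 4 * (norm w)\<^sup>2)) + - \<i> * of_real (\<tau> / 2 * phase_form z (z + w))))"
    by (rule arg_cong[where f=exp]) simp
  also have "\<dots> = exp (- \<gamma> * of_real (s * \<tau> / 4)) * (of_real (exp (- (?c / 4 * (norm w)\<^sup>2))) * cis (heat_phase \<tau> w z))"
    unfolding exp_add sy by (simp only: exp_of_real cis_conv_exp)
  finally have "kernel_at \<gamma> \<tau> (s, z) (z + w) = (complex_of_real ((tau_csch \<tau> s / (4 * pi)) ^ ?n) * exp (- \<gamma> * of_real (s * \<tau> / 4)))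
      * (of_real (exp (- (?c / 4 * (norm w)\<^sup>2))) * cis (heat_phase \<tau> w z))"
    unfolding kernel_at_alt by (simp only: mult.assoc)
  also have "\<dots> = heat_mass ?n \<gamma> \<tau> s * (of_real (gauss_density (?c / 4) w) * cis (heat_phase \<tau> w z))"
    unfolding m g of_real_mult by (simp only: mult.assoc)
  finally show ?thesis .
qed

lemma continuous_on_heat_integral:
  assumes "square_integrable f" and s: "s > 0"
  shows "continuous_on UNIV (heat_integral \<gamma> \<tau> f s)"
proof -
  have "continuous_on UNIV (\<lambda>z. LINT w|lebesgue. kernel_at \<gamma> \<tau> (s, z) w * f w)"
    using s by (intro continuous_on_compose2[OF gauss_dominated_continuous_integral[OF gauss_dominated_kernel_at assms(1)], of _ "\<lambda>z. (s, z)"])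
      (auto intro!: continuous_intros)
  then show ?thesis by (simp add: heat_integral_eq[abs_def])
qed

lemma heat_integral_twisted_average:
  fixes f :: "'n::finite phase_space \<Rightarrow> complex"
  assumes f [measurable]: "f \<in> borel_measurable borel" and s: "s > 0"
  shows "heat_integral \<gamma> \<tau> f s z = heat_mass CARD('n) \<gamma> \<tau> s
     * twisted_average (heat_phase \<tau>) (tau_coth \<tau> s / 4) f z"
proof -
  have [measurable]: "kernel_at \<gamma> \<tau> (s, z) \<in> borel_measurable borel"
    using gauss_dominated_continuous_right[OF gauss_dominated_kernel_at, of "(s, z)" \<gamma> \<tau>] s
    by (intro borel_measurable_continuous_onI) simp
  have "heat_integral \<gamma> \<tau> f s z = (LINT w|lborel. kernel_at \<gamma> \<tau> (s, z) w * f w)"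
    unfolding heat_integral_eq by (rule integral_completion) simp
  also have "\<dots> = (LINT w|distr lborel borel ((+) z). kernel_at \<gamma> \<tau> (s, z) w * f w)"
    by (simp add: lborel_distr_plus)
  also have "\<dots> = (LINT w|lborel. kernel_at \<gamma> \<tau> (s, z) (z + w) * f (z + w))"
    by (rule integral_distr) auto
  also have "\<dots> = (LINT w|lborel. heat_mass CARD('n) \<gamma> \<tau> s *
     (of_real (gauss_density (tau_coth \<tau> s / 4) w) * (cis (heat_phase \<tau> w z) * f (z + w))))"
    unfolding kernel_at_translate[OF s] by (simp only: mult.assoc)
  finally show ?thesis by (simp add: twisted_average_def)
qed

text \<open>
Tonelli's theorem needs \<open>(z, w) \<mapsto> f (z + w)\<close> to be measurable for a product sigma-algebra. This is
automatic for Borel functions, whereas the product of the Lebesgue sigma-algebras is not complete.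
\<close>

lemma square_integrable_borel_version:
  fixes f :: "'a::euclidean_space \<Rightarrow> complex"
  assumes "square_integrable f"
  obtains g where "g \<in> borel_measurable borel" "AE z in lebesgue. f z = g z"
    "(\<integral>\<^sup>+z. ennreal ((cmod (g z))\<^sup>2) \<partial>lborel) < \<infinity>"
proof -
  have f [measurable]: "f \<in> borel_measurable lebesgue" and int: "integrable lebesgue (\<lambda>z. (cmod (f z))\<^sup>2)"
    using assms by (auto simp: square_integrable_def)
  have "(\<lambda>z. Re (f z)) \<in> borel_measurable lebesgue" "(\<lambda>z. Im (f z)) \<in> borel_measurable lebesgue"
    by measurable
  then obtain r i where r [measurable]: "r \<in> borel_measurable lborel" "AE z in lborel. Re (f z) = r z"
    and i [measurable]: "i \<in> borel_measurable lborel" "AE z in lborel. Im (f z) = i z"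
    using completion_ex_borel_measurable_real by metis
  define g where "g z = Complex (r z) (i z)" for z
  have g_eq: "g = (\<lambda>z. of_real (r z) + \<i> * of_real (i z))" by (simp add: g_def fun_eq_iff complex_eq_iff)
  have g [measurable]: "g \<in> borel_measurable borel"
    using r(1) i(1) unfolding g_eq by simp
  have "AE z in lborel. f z = g z"
    using r(2) i(2) by eventually_elim (simp add: g_def complex_eq_iff)
  then have ae: "AE z in lebesgue. f z = g z" by (rule AE_completion)
  have "(\<integral>\<^sup>+z. ennreal ((cmod (g z))\<^sup>2) \<partial>lborel) = (\<integral>\<^sup>+z. ennreal ((cmod (g z))\<^sup>2) \<partial>lebesgue)"
    by (simp add: nn_integral_completion)
  also have "\<dots> = (\<integral>\<^sup>+z. ennreal ((cmod (f z))\<^sup>2) \<partial>lebesgue)"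
    by (rule nn_integral_cong_AE) (use ae in eventually_elim, simp)
  also have "\<dots> < \<infinity>"
    using int by (simp add: integrable_iff_bounded)
  finally show thesis using that g ae by blast
qed

lemma heat_integral_cong_AE:
  fixes f g :: "'n::finite phase_space \<Rightarrow> complex"
  assumes f: "square_integrable f" and g: "g \<in> borel_measurable borel" and ae: "AE z in lebesgue. f z = g z"
    and s: "s > 0"
  shows "heat_integral \<gamma> \<tau> f s = heat_integral \<gamma> \<tau> g s"
proof
  fix z :: "'n phase_space"
  have k: "kernel_at \<gamma> \<tau> (s, z) \<in> borel_measurable lebesgue"
    using borel_measurable_continuous_onI[OF gauss_dominated_continuous_right[OF gauss_dominated_kernel_at, of "(s, z)" \<gamma> \<tau>]] s
    by (intro measurable_completion) simp
  show "heat_integral \<gamma> \<tau> f s z = heat_integral \<gamma> \<tau> g s z"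
    unfolding heat_integral_eq
  proof (rule integral_cong_AE)
    have "g \<in> borel_measurable lebesgue" using g by (intro measurable_completion) simp
    then show "(\<lambda>w. kernel_at \<gamma> \<tau> (s, z) w * g w) \<in> borel_measurable lebesgue" using k by simp
    show "(\<lambda>w. kernel_at \<gamma> \<tau> (s, z) w * f w) \<in> borel_measurable lebesgue"
    proof -
      have "f \<in> borel_measurable lebesgue" using f by (simp add: square_integrable_def)
      then show ?thesis using k by simp
    qed
    show "AE w in lebesgue. kernel_at \<gamma> \<tau> (s, z) w * f w = kernel_at \<gamma> \<tau> (s, z) w * g w"
      using ae by eventually_elim simp
  qed
qed

text \<open>
With \<open>m\<close> the scalar and \<open>T\<close> the twisted average, \<open>m * T g - a * g = m * (T g - g) + (m - a) * g\<close>.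
The case \<open>a = 0\<close> gives the square integrability of the solution, the case \<open>a = 1\<close> its initial value.
\<close>

lemma heat_integral_L2_estimate:
  fixes g :: "'n::finite phase_space \<Rightarrow> complex"
  assumes g [measurable]: "g \<in> borel_measurable borel" and s: "s > 0"
  shows "(\<integral>\<^sup>+z. ennreal ((cmod (heat_integral \<gamma> \<tau> g s z - a * g z))\<^sup>2) \<partial>lborel)
     \<le> ennreal (2 * (cmod (heat_mass CARD('n) \<gamma> \<tau> s))\<^sup>2) *
         (\<integral>\<^sup>+z. ennreal ((cmod (twisted_average (heat_phase \<tau>) (tau_coth \<tau> s / 4) g z - g z))\<^sup>2) \<partial>lborel)
       + ennreal (2 * (cmod (heat_mass CARD('n) \<gamma> \<tau> s - a))\<^sup>2) * (\<integral>\<^sup>+z. ennreal ((cmod (g z))\<^sup>2) \<partial>lborel)"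
proof -
  let ?m = "heat_mass CARD('n) \<gamma> \<tau> s"
  let ?T = "twisted_average (heat_phase \<tau>) (tau_coth \<tau> s / 4) g"
  have [measurable]: "?T \<in> borel_measurable borel"
    by (rule measurable_twisted_average[OF continuous_on_heat_phase g])
  have "(\<integral>\<^sup>+z. ennreal ((cmod (heat_integral \<gamma> \<tau> g s z - a * g z))\<^sup>2) \<partial>lborel)
    \<le> (\<integral>\<^sup>+z. ennreal (2 * (cmod ?m)\<^sup>2) * ennreal ((cmod (?T z - g z))\<^sup>2) + ennreal (2 * (cmod (?m - a))\<^sup>2) * ennreal ((cmod (g z))\<^sup>2) \<partial>lborel)"
  proof (intro nn_integral_mono)
    fix z
    have "heat_integral \<gamma> \<tau> g s z - a * g z = ?m * (?T z - g z) - (a - ?m) * g z"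
      unfolding heat_integral_twisted_average[OF g s] by (simp add: algebra_simps)
    then have "(cmod (heat_integral \<gamma> \<tau> g s z - a * g z))\<^sup>2 \<le> 2 * (cmod ?m)\<^sup>2 * (cmod (?T z - g z))\<^sup>2 + 2 * (cmod (?m - a))\<^sup>2 * (cmod (g z))\<^sup>2"
      using cmod_diff_square_le[of "?m * (?T z - g z)" "(a - ?m) * g z"] 
      by (simp add: norm_mult power_mult_distrib norm_minus_commute)
    from ennreal_leI[OF this]
    show "ennreal ((cmod (heat_integral \<gamma> \<tau> g s z - a * g z))\<^sup>2) \<le> ennreal (2 * (cmod ?m)\<^sup>2) * ennreal ((cmod (?T z - g z))\<^sup>2) 
         + ennreal (2 * (cmod (?m - a))\<^sup>2) * ennreal ((cmod (g z))\<^sup>2)"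
      by (simp only: ennreal_plus ennreal_mult zero_le_power2 mult_nonneg_nonneg zero_le_numeral)
  qed
  also have "\<dots> = ennreal (2 * (cmod ?m)\<^sup>2) * (\<integral>\<^sup>+z. ennreal ((cmod (?T z - g z))\<^sup>2) \<partial>lborel)
     + ennreal (2 * (cmod (?m - a))\<^sup>2) * (\<integral>\<^sup>+z. ennreal ((cmod (g z))\<^sup>2) \<partial>lborel)"
    by (subst nn_integral_add, measurable) (subst nn_integral_cmult; measurable)+
  finally show ?thesis .
qed

lemma square_integrable_heat_integral:
  fixes f :: "'n::finite phase_space \<Rightarrow> complex"
  assumes f: "square_integrable f" and s: "s > 0"
  shows "square_integrable (heat_integral \<gamma> \<tau> f s)"
proof -
  obtain g where g: "g \<in> borel_measurable borel" and ae: "AE z in lebesgue. f z = g z"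
    and fin: "(\<integral>\<^sup>+z. ennreal ((cmod (g z))\<^sup>2) \<partial>lborel) < \<infinity>"
    using square_integrable_borel_version[OF f] .
  let ?u = "heat_integral \<gamma> \<tau> f s"
  have u [measurable]: "?u \<in> borel_measurable borel"
    by (rule borel_measurable_continuous_onI[OF continuous_on_heat_integral[OF f s]])
  have c: "tau_coth \<tau> s / 4 > 0" using tau_coth_pos[OF s] by simp
  have "(\<integral>\<^sup>+z. ennreal ((cmod (twisted_average (heat_phase \<tau>) (tau_coth \<tau> s / 4) g z - g z))\<^sup>2) \<partial>lborel)
    \<le> 4 * (\<integral>\<^sup>+z. ennreal ((cmod (g z))\<^sup>2) \<partial>lborel)"
    by (rule twisted_average_diff_bounded[OF c continuous_on_heat_phase g fin])
  also have "\<dots> < \<infinity>" using fin by (simp add: ennreal_mult_less_top)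
  finally have "(\<integral>\<^sup>+z. ennreal ((cmod (?u z))\<^sup>2) \<partial>lborel) < \<infinity>"
    using heat_integral_L2_estimate[OF g s, of \<gamma> \<tau> 0] fin
    unfolding heat_integral_cong_AE[OF f g ae s]
    by (auto elim!: le_less_trans simp: ennreal_mult_less_top)
  then have "integrable lborel (\<lambda>z. (cmod (?u z))\<^sup>2)"
    by (intro integrableI_nonneg) auto
  moreover have "(\<lambda>z. (cmod (?u z))\<^sup>2) \<in> borel_measurable lborel" by measurable
  moreover have "?u \<in> borel_measurable lebesgue"
    using u by (intro measurable_completion) simp
  ultimately show ?thesis
    unfolding square_integrable_def by (simp only: integrable_completion)
qed

lemma heat_integral_tendsto:
  fixes f :: "'n::finite phase_space \<Rightarrow> complex"
  assumes f: "square_integrable f"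
  shows "((\<lambda>s. L2_norm (\<lambda>z. heat_integral \<gamma> \<tau> f s z - f z)) \<longlongrightarrow> 0) (at_right 0)"
proof -
  obtain g where g [measurable]: "g \<in> borel_measurable borel" and ae: "AE z in lebesgue. f z = g z"
    and fin: "(\<integral>\<^sup>+z. ennreal ((cmod (g z))\<^sup>2) \<partial>lborel) < \<infinity>"
    using square_integrable_borel_version[OF f] .
  have f_meas: "f \<in> borel_measurable lebesgue" using f by (simp add: square_integrable_def)
  define m where "m = heat_mass CARD('n) \<gamma> \<tau>"
  define E where "E s = (\<integral>\<^sup>+z. ennreal ((cmod (twisted_average (heat_phase \<tau>) (tau_coth \<tau> s / 4) g z - g z))\<^sup>2) \<partial>lborel)" for s
  define N where "N = (\<integral>\<^sup>+z. ennreal ((cmod (g z))\<^sup>2) \<partial>lborel)"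
  define B where "B s = 2 * (cmod (m s))\<^sup>2 * enn2real (E s) + 2 * (cmod (m s - 1))\<^sup>2 * enn2real N" for s
  have le: "(L2_norm (\<lambda>z. heat_integral \<gamma> \<tau> f s z - f z))\<^sup>2 \<le> B s" if s: "s > 0" for s
  proof -
    let ?u = "heat_integral \<gamma> \<tau> f s"
    have u: "?u \<in> borel_measurable borel"
      by (rule borel_measurable_continuous_onI[OF continuous_on_heat_integral[OF f s]])
    have c: "tau_coth \<tau> s / 4 > 0" using tau_coth_pos[OF s] by simp
    have "E s \<le> 4 * N"
      unfolding E_def N_def by (rule twisted_average_diff_bounded[OF c continuous_on_heat_phase g fin])
    also have "\<dots> < \<infinity>" using fin by (simp add: N_def ennreal_mult_less_top)
    finally have "E s < \<infinity>" .
    then have E: "ennreal (enn2real (E s)) = E s" by simp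
    have N: "ennreal (enn2real N) = N" using fin by (simp add: N_def)
    have meas: "(\<lambda>z. ?u z - f z) \<in> borel_measurable lebesgue"
      using f_meas measurable_completion[of ?u lborel borel] u by auto
    have "(L2_norm (\<lambda>z. ?u z - f z))\<^sup>2 = (LINT z|lebesgue. (cmod (?u z - f z))\<^sup>2)"
      by (simp add: L2_norm_def)
    also have "\<dots> = enn2real (\<integral>\<^sup>+z. ennreal ((cmod (?u z - f z))\<^sup>2) \<partial>lebesgue)"
      using meas by (intro integral_eq_nn_integral) auto
    also have "(\<integral>\<^sup>+z. ennreal ((cmod (?u z - f z))\<^sup>2) \<partial>lebesgue) = (\<integral>\<^sup>+z. ennreal ((cmod (?u z - g z))\<^sup>2) \<partial>lebesgue)"
      by (rule nn_integral_cong_AE) (use ae in eventually_elim, simp)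
    also have "\<dots> = (\<integral>\<^sup>+z. ennreal ((cmod (heat_integral \<gamma> \<tau> g s z - 1 * g z))\<^sup>2) \<partial>lborel)"
      unfolding heat_integral_cong_AE[OF f g ae s] by (simp add: nn_integral_completion)
    also have "enn2real \<dots> \<le> enn2real (ennreal (B s))"
    proof (rule enn2real_mono)
      have "(\<integral>\<^sup>+z. ennreal ((cmod (heat_integral \<gamma> \<tau> g s z - 1 * g z))\<^sup>2) \<partial>lborel)
        \<le> ennreal (2 * (cmod (m s))\<^sup>2) * E s + ennreal (2 * (cmod (m s - 1))\<^sup>2) * N"
        unfolding m_def E_def N_def by (rule heat_integral_L2_estimate[OF g s])
      also have "\<dots> = ennreal (2 * (cmod (m s))\<^sup>2) * ennreal (enn2real (E s)) + ennreal (2 * (cmod (m s - 1))\<^sup>2) * ennreal (enn2real N)"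
        unfolding E N ..
      also have "\<dots> = ennreal (B s)"
        unfolding B_def by (simp only: ennreal_plus ennreal_mult zero_le_power2 mult_nonneg_nonneg zero_le_numeral enn2real_nonneg)
      finally show "(\<integral>\<^sup>+z. ennreal ((cmod (heat_integral \<gamma> \<tau> g s z - 1 * g z))\<^sup>2) \<partial>lborel) \<le> ennreal (B s)" .
    qed simp
    also have "\<dots> = B s" by (rule enn2real_ennreal) (simp add: B_def)
    finally show ?thesis .
  qed
  have "filterlim (\<lambda>s. tau_coth \<tau> s / 4) at_top (at_right 0)"
    using filterlim_tendsto_pos_mult_at_top[OF tendsto_const[of "1/4"] _ filterlim_tau_coth[of \<tau>]] by simp
  moreover have "((\<lambda>a. \<integral>\<^sup>+z. ennreal ((cmod (twisted_average (heat_phase \<tau>) a g z - g z))\<^sup>2) \<partial>lborel) \<longlongrightarrow> 0) at_top"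
    by (rule twisted_average_tendsto[OF continuous_on_heat_phase _ g fin]) (simp add: heat_phase_def)
  ultimately have "(E \<longlongrightarrow> 0) (at_right 0)"
    unfolding E_def[abs_def] by (rule filterlim_compose[rotated])
  then have "((\<lambda>s. enn2real (E s)) \<longlongrightarrow> enn2real 0) (at_right 0)"
    by (intro tendsto_enn2real) auto
  then have E0: "((\<lambda>s. enn2real (E s)) \<longlongrightarrow> 0) (at_right 0)" by simp
  have m1: "(m \<longlongrightarrow> 1) (at_right 0)"
    unfolding m_def by (rule tendsto_heat_mass)
  have "(B \<longlongrightarrow> 2 * (cmod 1)\<^sup>2 * 0 + 2 * (cmod (1 - 1))\<^sup>2 * enn2real N) (at_right 0)"
    unfolding B_def[abs_def] by (intro tendsto_intros m1 E0)
  then have B0: "(B \<longlongrightarrow> 0) (at_right 0)" by simp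
  have "((\<lambda>s. (L2_norm (\<lambda>z. heat_integral \<gamma> \<tau> f s z - f z))\<^sup>2) \<longlongrightarrow> 0) (at_right 0)"
  proof (rule tendsto_sandwich[OF _ _ tendsto_const B0])
    show "\<forall>\<^sub>F s in at_right 0. (L2_norm (\<lambda>z. heat_integral \<gamma> \<tau> f s z - f z))\<^sup>2 \<le> B s"
      using eventually_at_right_less[of 0] by (rule eventually_mono) (rule le)
  qed simp
  then have "((\<lambda>s. sqrt ((L2_norm (\<lambda>z. heat_integral \<gamma> \<tau> f s z - f z))\<^sup>2)) \<longlongrightarrow> sqrt 0) (at_right 0)"
    by (rule tendsto_real_sqrt)
  moreover have "L2_norm h \<ge> 0" for h :: "'n phase_space \<Rightarrow> complex"
    by (simp add: L2_norm_def)
  ultimately show ?thesis by simp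
qed

theorem corollary1p4:
  fixes \<gamma> :: complex and \<tau> :: real
    and f :: "(real^'n) \<times> (real^'n) \<Rightarrow> complex"
  assumes "square_integrable f"
  shows "(\<forall>s>0. \<forall>x y. integrable lebesgue
            (\<lambda>(x', y'). heat_kernel \<gamma> \<tau> s x y x' y' * f (x', y')))
       \<and> C12_pos (heat_integral \<gamma> \<tau> f)
       \<and> (\<forall>s>0. \<forall>x y.
            vector_derivative (\<lambda>\<sigma>. heat_integral \<gamma> \<tau> f \<sigma> (x, y)) (at s)
            + L_tilde \<gamma> \<tau> (heat_integral \<gamma> \<tau> f s) (x, y) = 0)
       \<and> (\<forall>s>0. square_integrable (heat_integral \<gamma> \<tau> f s))
       \<and> ((\<lambda>s. L2_norm (\<lambda>z. heat_integral \<gamma> \<tau> f s z - f z)) \<longlongrightarrow> 0) (at_right 0)"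
proof (intro conjI allI impI)
  fix s :: real and x y :: "real^'n" assume s: "s > 0"
  have "integrable lebesgue (\<lambda>w. kernel_at \<gamma> \<tau> (s, (x, y)) w * f w)"
    using s by (intro gauss_dominated_integrable[OF gauss_dominated_kernel_at _ assms]) simp
  then show "integrable lebesgue (\<lambda>(x', y'). heat_kernel \<gamma> \<tau> s x y x' y' * f (x', y'))"
    by (simp add: kernel_at_def split_def)
  show "vector_derivative (\<lambda>\<sigma>. heat_integral \<gamma> \<tau> f \<sigma> (x, y)) (at s)
            + L_tilde \<gamma> \<tau> (heat_integral \<gamma> \<tau> f s) (x, y) = 0"
    by (rule heat_integral_solves[OF assms s])
  show "square_integrable (heat_integral \<gamma> \<tau> f s)"
    by (rule square_integrable_heat_integral[OF assms s])
qed (rule C12_pos_heat_integral[OF assms] heat_integral_tendsto[OF assms])+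

end
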